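(* Let $(M,p_0)$ be a based tree-like homotopy space. Then endpoint projection $\pi:(\mathcal{P}_M,[p_0])\to(M,p_0)$ satisfies the unique lifting property and the universal path space $\mathcal{P}_M$ is a Lipschitz simply connected length space.
   Context: All paths and loops are Lipschitz with domain $I=[0,1]$ (Euclidean metric) unless stated otherwise; $\ell(\gamma)$ is the length of $\gamma$, $\overline{\gamma}$ the inverse path, $*$ concatenation, $\mathrm{Im}$ denotes image, $\mathrm{Lip}(f)$ the (least) Lipschitz constant. $I\times I$ carries the $L^1$ metric. Two paths $\gamma,\gamma'$ in $M$ with the same initial points and the same end points are homotopic rel endpoints, $\gamma\simeq\gamma'$, if there is a Lipschitz map $H:I\times I\to M$ (a homotopy from $\gamma$ to $\gamma'$) with $H|_{I\times\{0\}}=\gamma$, $H|_{I\times\{1\}}=\gamma'$, $H|_{\{0\}\times I}\equiv\gamma(0)$, $H|_{\{1\}\times I}\equiv\gamma(1)$; $[\gamma]$ denotes the class of $\gamma$. A length minimizing path in $[\gamma]$ is a representative of least length. A path $\gamma:[a,b]\to M$ is arc length parametrized if $\ell(\gamma|_{[t_1,t_2]})=\frac{\ell(\gamma)}{b-a}|t_1-t_2|$ for all $t_1,t_2\in[a,b]$. The first Lipschitz homotopy group $\pi_1^{\mathrm{Lip}}(M,p_0)$ is the set of classes of loops based at $p_0$ with group operation given by concatenation; a based Lipschitz map $f$ induces $f_\#[\alpha]=[f\circ\alpha]$. A space is Lipschitz simply connected if any two points are joined by a Lipschitz path and its first Lipschitz homotopy group is trivial. A metric space $M$ is a tree-like homotopy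 space if for any paths $\gamma,\beta:I\to M$ that are homotopic rel endpoints, there exist a Lipschitz map $H':I\times I\to M$ and a path $\beta':I\to M$ such that: $H'$ is a homotopy from $\gamma$ to $\beta'$; $\mathrm{Lip}(H')=\mathrm{Lip}(\gamma)$; $\mathrm{Im}(H')\subset\mathrm{Im}(\gamma)$; $\mathrm{Lip}(\beta')\le\mathrm{Lip}(\gamma)$; $\mathrm{Im}(\beta')\subset\mathrm{Im}(\gamma)$; and $\ell(\beta')\le\ell(\beta)$. Additionally, if $\beta$ is arc length parametrized and a length minimizing path in $[\gamma]$, then $\beta'=\beta$. The universal (Lipschitz) path space of $(M,p_0)$ is $\mathcal{P}_M=\{[\gamma] : \gamma:I\to M \text{ Lipschitz},\ \gamma(0)=p_0\}$, with base point $[p_0]$ (the class of the constant loop) and lifted pseudo-metric $d_{\mathcal{P}}([\gamma_1],[\gamma_2])=\inf\{\ell(\beta):\beta\simeq\overline{\gamma_1}*\gamma_2\}$. Endpoint projection is $\pi:\mathcal{P}_M\to M$, $\pi([\gamma])=\gamma(1)$. A metric space $(X,d)$ is quasi-convex if there is $C\ge1$ such that any $x_1,x_2\in X$ are joined by a Lipschitz path $\gamma$ with $\ell(\gamma)\le C\,d(x_1,x_2)$; it is a length space if every $C>1$ works. A based Lipschitz map $r:(E,e_0)\to(M,p_0)$ satisfies the unique lifting property if for every based quasi-convex metric space $(X,x_0)$ and every based Lipschitz map $f:(X,x_0)\to(M,p_0)$ such that $f_\#:\pi_1^{\mathrm{Lip}}(X,x_0)\to\pi_1^{\mathrm{Lip}}(M,p_0)$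 is trivial, there exists a unique based Lipschitz map $\widehat f:(X,x_0)\to(E,e_0)$ with $r\circ\widehat f=f$. *)

theory Defs
  imports "HOL-Analysis.Analysis" "HOL-Algebra.Elementary_Groups"
begin

text \<open>
  Metric spaces are values of the library type \<open>'a metric\<close>. A path is a function on \<open>real\<close> of
  which only the values on \<open>{0..1}\<close> matter; accordingly, paths are compared pointwise on \<open>{0..1}\<close>,
  and a homotopy class is closed under changing representatives outside \<open>{0..1}\<close>.
\<close>

section \<open>Lipschitz paths, Lipschitz constants, length\<close>

definition interval_metric :: "real metric" where
  "interval_metric = submetric euclidean_metric {0..1}"

text \<open>The square carries the \<open>L\<^sup>1\<close> metric; the library's \<open>prod_metric\<close> is the Euclidean one.\<close>

definition square_metric :: "(real \<times> real) metric" where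
  "square_metric = metric ({0..1} \<times> {0..1}, \<lambda>p q. \<bar>fst p - fst q\<bar> + \<bar>snd p - snd q\<bar>)"

lemma Metric_space_square:
  "Metric_space ({0..1} \<times> {0..1}) (\<lambda>p q :: real \<times> real. \<bar>fst p - fst q\<bar> + \<bar>snd p - snd q\<bar>)"
  by unfold_locales (auto simp: prod_eq_iff)

lemma mspace_square [simp]: "mspace square_metric = {0..1} \<times> {0..1}"
  unfolding square_metric_def by (rule Metric_space.mspace_metric [OF Metric_space_square])

lemma mdist_square [simp]:
  "mdist square_metric p q = \<bar>fst p - fst q\<bar> + \<bar>snd p - snd q\<bar>"
  unfolding square_metric_def by (simp add: Metric_space.mdist_metric [OF Metric_space_square])

definition lip_path :: "'a metric \<Rightarrow> (real \<Rightarrow> 'a) \<Rightarrow> bool" where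
  "lip_path M \<gamma> \<longleftrightarrow> Lipschitz_continuous_map interval_metric M \<gamma>"

text \<open>Meaningful for Lipschitz maps only, where the infimum is attained.\<close>

definition lip_const :: "'b metric \<Rightarrow> 'a metric \<Rightarrow> ('b \<Rightarrow> 'a) \<Rightarrow> real" where
  "lip_const X M f =
     Inf {B. 0 \<le> B \<and> (\<forall>x \<in> mspace X. \<forall>y \<in> mspace X. mdist M (f x) (f y) \<le> B * mdist X x y)}"

text \<open>
  Length of the restriction of \<open>\<gamma>\<close> to \<open>{a..b}\<close>, a supremum over partitions. It is real-valued since
  only Lipschitz paths, which have finite length, are considered.
\<close>

definition length_on :: "'a metric \<Rightarrow> real \<Rightarrow> real \<Rightarrow> (real \<Rightarrow> 'a) \<Rightarrow> real" where
  "length_on M a b \<gamma> =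
     Sup {(\<Sum>i<n. mdist M (\<gamma> (t i)) (\<gamma> (t (Suc i)))) | (n :: nat) (t :: nat \<Rightarrow> real).
            t 0 = a \<and> t n = b \<and> (\<forall>i<n. t i \<le> t (Suc i))}"

abbreviation length_of :: "'a metric \<Rightarrow> (real \<Rightarrow> 'a) \<Rightarrow> real" where
  "length_of M \<equiv> length_on M 0 1"

definition arc_length_parametrized :: "'a metric \<Rightarrow> real \<Rightarrow> real \<Rightarrow> (real \<Rightarrow> 'a) \<Rightarrow> bool" where
  "arc_length_parametrized M a b \<gamma> \<longleftrightarrow>
     (\<forall>t1 \<in> {a..b}. \<forall>t2 \<in> {a..b}. t1 \<le> t2 \<longrightarrow>
        length_on M t1 t2 \<gamma> = length_on M a b \<gamma> / (b - a) * \<bar>t1 - t2\<bar>)"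

text \<open>
  As \<open>reversepath\<close> and \<open>joinpaths\<close>, which however require the points to form a topological
  type class.
\<close>

definition inverse_path :: "(real \<Rightarrow> 'a) \<Rightarrow> real \<Rightarrow> 'a" where
  "inverse_path \<gamma> = (\<lambda>t. \<gamma> (1 - t))"

definition concat_path :: "(real \<Rightarrow> 'a) \<Rightarrow> (real \<Rightarrow> 'a) \<Rightarrow> real \<Rightarrow> 'a" where
  "concat_path \<gamma> \<gamma>' = (\<lambda>t. if t \<le> 1/2 then \<gamma> (2 * t) else \<gamma>' (2 * t - 1))"

section \<open>Lipschitz homotopy\<close>

definition lip_homotopy ::
    "'a metric \<Rightarrow> (real \<Rightarrow> 'a) \<Rightarrow> (real \<Rightarrow> 'a) \<Rightarrow> (real \<times> real \<Rightarrow> 'a) \<Rightarrow> bool" where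
  "lip_homotopy M \<gamma> \<gamma>' H \<longleftrightarrow>
     Lipschitz_continuous_map square_metric M H \<and>
     (\<forall>s \<in> {0..1}. H (s, 0) = \<gamma> s) \<and> (\<forall>s \<in> {0..1}. H (s, 1) = \<gamma>' s) \<and>
     (\<forall>t \<in> {0..1}. H (0, t) = \<gamma> 0) \<and> (\<forall>t \<in> {0..1}. H (1, t) = \<gamma> 1)"

definition lip_homotopic :: "'a metric \<Rightarrow> (real \<Rightarrow> 'a) \<Rightarrow> (real \<Rightarrow> 'a) \<Rightarrow> bool" where
  "lip_homotopic M \<gamma> \<gamma>' \<longleftrightarrow>
     lip_path M \<gamma> \<and> lip_path M \<gamma>' \<and> \<gamma> 0 = \<gamma>' 0 \<and> \<gamma> 1 = \<gamma>' 1 \<and> (\<exists>H. lip_homotopy M \<gamma> \<gamma>' H)"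

definition path_class :: "'a metric \<Rightarrow> (real \<Rightarrow> 'a) \<Rightarrow> (real \<Rightarrow> 'a) set" where
  "path_class M \<gamma> = {\<gamma>'. lip_homotopic M \<gamma> \<gamma>'}"

definition length_minimizing_in :: "'a metric \<Rightarrow> (real \<Rightarrow> 'a) set \<Rightarrow> (real \<Rightarrow> 'a) \<Rightarrow> bool" where
  "length_minimizing_in M c \<beta> \<longleftrightarrow> \<beta> \<in> c \<and> (\<forall>\<gamma> \<in> c. length_of M \<beta> \<le> length_of M \<gamma>)"

definition tree_like_homotopy_space :: "'a metric \<Rightarrow> bool" where
  "tree_like_homotopy_space M \<longleftrightarrow>
     (\<forall>\<gamma> \<beta>. lip_homotopic M \<gamma> \<beta> \<longrightarrow>
        (\<exists>H' \<beta>'. lip_path M \<beta>' \<and> lip_homotopy M \<gamma> \<beta>' H' \<and>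
           lip_const square_metric M H' = lip_const interval_metric M \<gamma> \<and>
           H' ` ({0..1} \<times> {0..1}) \<subseteq> \<gamma> ` {0..1} \<and>
           lip_const interval_metric M \<beta>' \<le> lip_const interval_metric M \<gamma> \<and>
           \<beta>' ` {0..1} \<subseteq> \<gamma> ` {0..1} \<and>
           length_of M \<beta>' \<le> length_of M \<beta> \<and>
           (arc_length_parametrized M 0 1 \<beta> \<and> length_minimizing_in M (path_class M \<gamma>) \<beta> \<longrightarrow>
              (\<forall>t \<in> {0..1}. \<beta>' t = \<beta> t))))"

section \<open>The first Lipschitz homotopy group\<close>

text \<open>
  Operations on classes are given as the union of the classes obtained from all choices of
  representatives; these classes coincide.
\<close>

definition lip_pi1 :: "'a metric \<Rightarrow> 'a \<Rightarrow> (real \<Rightarrow> 'a) set monoid" where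
  "lip_pi1 M p0 =
     \<lparr>carrier = {path_class M \<alpha> | \<alpha>. lip_path M \<alpha> \<and> \<alpha> 0 = p0 \<and> \<alpha> 1 = p0},
      mult = (\<lambda>A B. \<Union>\<alpha> \<in> A. \<Union>\<beta> \<in> B. path_class M (concat_path \<alpha> \<beta>)),
      one = path_class M (\<lambda>_. p0)\<rparr>"

definition induced_map ::
    "'b metric \<Rightarrow> ('a \<Rightarrow> 'b) \<Rightarrow> (real \<Rightarrow> 'a) set \<Rightarrow> (real \<Rightarrow> 'b) set" where
  "induced_map N f A = (\<Union>\<alpha> \<in> A. path_class N (f \<circ> \<alpha>))"

text \<open>Triviality of the group is required at every base point, so none has to be chosen.\<close>

definition lip_simply_connected :: "'a metric \<Rightarrow> bool" where
  "lip_simply_connected M \<longleftrightarrow>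
     (\<forall>x \<in> mspace M. \<forall>y \<in> mspace M. \<exists>\<gamma>. lip_path M \<gamma> \<and> \<gamma> 0 = x \<and> \<gamma> 1 = y) \<and>
     (\<forall>x \<in> mspace M. trivial_group (lip_pi1 M x))"

section \<open>Quasi-convex spaces and length spaces\<close>

definition quasi_convex_with :: "real \<Rightarrow> 'a metric \<Rightarrow> bool" where
  "quasi_convex_with C X \<longleftrightarrow>
     (\<forall>x \<in> mspace X. \<forall>y \<in> mspace X.
        \<exists>\<gamma>. lip_path X \<gamma> \<and> \<gamma> 0 = x \<and> \<gamma> 1 = y \<and> length_of X \<gamma> \<le> C * mdist X x y)"

definition quasi_convex :: "'a metric \<Rightarrow> bool" where
  "quasi_convex X \<longleftrightarrow> (\<exists>C \<ge> 1. quasi_convex_with C X)"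

definition length_space :: "'a metric \<Rightarrow> bool" where
  "length_space X \<longleftrightarrow> (\<forall>C > 1. quasi_convex_with C X)"

section \<open>The unique lifting property\<close>

definition based_lip_map :: "'a metric \<Rightarrow> 'a \<Rightarrow> 'b metric \<Rightarrow> 'b \<Rightarrow> ('a \<Rightarrow> 'b) \<Rightarrow> bool" where
  "based_lip_map X x0 M p0 f \<longleftrightarrow>
     x0 \<in> mspace X \<and> p0 \<in> mspace M \<and> Lipschitz_continuous_map X M f \<and> f x0 = p0"

text \<open>
  HOL cannot quantify over types, so the type of the points of the test spaces \<open>X\<close> is a parameter.
  The lift is taken extensional, since its values outside \<open>mspace X\<close> are immaterial.
\<close>

definition unique_lifting_property ::
    "'x itself \<Rightarrow> 'e metric \<Rightarrow> 'e \<Rightarrow> 'a metric \<Rightarrow> 'a \<Rightarrow> ('e \<Rightarrow> 'a) \<Rightarrow> bool" where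
  "unique_lifting_property _ E e0 M p0 r \<longleftrightarrow>
     based_lip_map E e0 M p0 r \<and>
     (\<forall>(X :: 'x metric) x0 f.
        quasi_convex X \<and> based_lip_map X x0 M p0 f \<and>
        trivial_homomorphism (lip_pi1 X x0) (lip_pi1 M p0) (induced_map M f) \<longrightarrow>
        (\<exists>!g. g \<in> extensional (mspace X) \<and> based_lip_map X x0 E e0 g \<and>
              (\<forall>x \<in> mspace X. r (g x) = f x)))"

section \<open>The universal path space\<close>

definition path_space :: "'a metric \<Rightarrow> 'a \<Rightarrow> (real \<Rightarrow> 'a) set set" where
  "path_space M p0 = {path_class M \<gamma> | \<gamma>. lip_path M \<gamma> \<and> \<gamma> 0 = p0}"

text \<open>
  The infimum does not depend on the representatives of \<open>A\<close> and \<open>B\<close>. The value off the path space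
  is set to \<open>0\<close> because \<open>Metric_space\<close> demands nonnegativity and symmetry for all arguments, not
  only for those in the carrier.
\<close>

definition path_space_dist ::
    "'a metric \<Rightarrow> 'a \<Rightarrow> (real \<Rightarrow> 'a) set \<Rightarrow> (real \<Rightarrow> 'a) set \<Rightarrow> real" where
  "path_space_dist M p0 A B =
     (if A \<in> path_space M p0 \<and> B \<in> path_space M p0
      then Inf {length_of M \<beta> | \<beta>. \<exists>\<gamma>1 \<in> A. \<exists>\<gamma>2 \<in> B.
                  lip_homotopic M \<beta> (concat_path (inverse_path \<gamma>1) \<gamma>2)}
      else 0)"

text \<open>
  In general \<open>path_space_dist\<close> is only a pseudo-metric, in which case the following value is
  unspecified; it is to be used together with
  \<open>Metric_space (path_space M p0) (path_space_dist M p0)\<close>.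
\<close>

definition path_space_metric :: "'a metric \<Rightarrow> 'a \<Rightarrow> (real \<Rightarrow> 'a) set metric" where
  "path_space_metric M p0 = metric (path_space M p0, path_space_dist M p0)"

text \<open>All representatives of a class have the same end point.\<close>

definition endpoint_proj :: "(real \<Rightarrow> 'a) set \<Rightarrow> 'a" where
  "endpoint_proj A = (SOME \<gamma>. \<gamma> \<in> A) 1"

end

theory Submission
  imports Defs
begin

text \<open>
  Write \<open>\<P>\<close> for the path space and \<open>\<pi>\<close> for the end point projection. Two facts about a tree-like
  homotopy space \<open>M\<close> carry the theorem; the rest is covering space theory with Lipschitz paths.

  First, every homotopy class of paths contains an arc length parametrized path of least length
  (\<open>arc_length_minimizer_exists\<close>). The tree-like property deforms \<open>\<gamma>\<close> into paths whose lengths approach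
  the infimum by homotopies that share the Lipschitz constant of \<open>\<gamma>\<close> and stay in the compact set
  \<open>Im \<gamma>\<close>. A cluster point of these homotopies exists by compactness, is again a homotopy, and ends in
  a path whose length is the infimum. Consequently the infimum defining the distance of \<open>\<P>\<close> is attained,
  and classes at distance \<open>0\<close> are connected by a constant path, hence equal: the pseudo-metric is a
  metric (\<open>Metric_space_path_space\<close>).

  Second, Lipschitz paths lift uniquely: a Lipschitz path \<open>c\<close> in \<open>\<P>\<close> ends in the class \<open>c 0\<close> continued
  along \<open>\<pi> \<circ> c\<close> (\<open>connects_projected_path\<close>). Connecting the values of \<open>c\<close> at dyadic points by almost
  shortest paths in \<open>M\<close> gives paths \<open>\<beta> n\<close> in one homotopy class, with a common Lipschitz constant,
  that converge uniformly to \<open>\<pi> \<circ> c\<close>. Let \<open>\<delta>\<close> be the minimizer of that class. The tree-like property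
  gives homotopies from \<open>\<beta> n\<close> to this same \<open>\<delta>\<close> within \<open>Im (\<beta> n)\<close>, whose cluster point is a homotopy from
  \<open>\<pi> \<circ> c\<close> to \<open>\<delta>\<close>.

  A map from a convex domain lifts to \<open>\<P>\<close> by continuing a class along images of segments
  (\<open>convex_domain_lift\<close>). Applied to an almost shortest connecting path this shows that \<open>\<P>\<close> is a length
  space. Applied to a null-homotopy of the projection of a loop in \<open>\<P>\<close>, and combined with unique path
  lifting on the boundary of the square, it shows that \<open>\<P>\<close> is Lipschitz simply connected. Finally, a
  map \<open>f\<close> from a quasi-convex space that is trivial on \<open>\<pi>\<^sub>1\<close> lifts by continuing the base class along
  the images of paths from the base point; the lift is Lipschitz by quasi-convexity and unique by
  unique path lifting.
\<close>

section \<open>Lipschitz maps on subsets of metric type classes\<close>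

text \<open>
  The domain is a subset of a metric type class rather than a value of type \<open>metric\<close>, so that real
  intervals, squares and other convex sets of a normed space can be used as parameter domains with
  the Lipschitz calculus and the convexity results for type classes.
\<close>

definition lip_on :: "'a metric \<Rightarrow> real \<Rightarrow> 'b::metric_space set \<Rightarrow> ('b \<Rightarrow> 'a) \<Rightarrow> bool" where
  "lip_on M L D F \<longleftrightarrow> 0 \<le> L \<and> (\<forall>x\<in>D. F x \<in> mspace M) \<and>
     (\<forall>x\<in>D. \<forall>y\<in>D. mdist M (F x) (F y) \<le> L * dist x y)"

lemma lip_onI:
  assumes "0 \<le> L" "\<And>x. x \<in> D \<Longrightarrow> F x \<in> mspace M"
    "\<And>x y. x \<in> D \<Longrightarrow> y \<in> D \<Longrightarrow> mdist M (F x) (F y) \<le> L * dist x y"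
  shows "lip_on M L D F"
  using assms by (auto simp: lip_on_def)

lemma lip_onD:
  assumes "lip_on M L D F" "x \<in> D" "y \<in> D"
  shows "mdist M (F x) (F y) \<le> L * dist x y"
  using assms by (auto simp: lip_on_def)

lemma lip_on_mspace: "lip_on M L D F \<Longrightarrow> x \<in> D \<Longrightarrow> F x \<in> mspace M"
  by (auto simp: lip_on_def)

lemma lip_on_nonneg: "lip_on M L D F \<Longrightarrow> 0 \<le> L"
  by (auto simp: lip_on_def)

lemma lip_on_mono:
  assumes "lip_on M L E F" "D \<subseteq> E" "L \<le> K"
  shows "lip_on M K D F"
  using assms unfolding lip_on_def
  by (meson dual_order.trans mult_right_mono subsetD zero_le_dist)

lemma lip_on_cong:
  assumes "\<And>x. x \<in> D \<Longrightarrow> F x = G x"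
  shows "lip_on M L D F \<longleftrightarrow> lip_on M L D G"
  using assms by (auto simp: lip_on_def)

lemma mdist_self [simp]: "p \<in> mspace M \<Longrightarrow> mdist M p p = 0"
  by simp

lemma lip_on_const: "p \<in> mspace M \<Longrightarrow> 0 \<le> L \<Longrightarrow> lip_on M L D (\<lambda>_. p)"
  by (auto simp: lip_on_def)

lemma lip_on_compose:
  assumes "lip_on M L E F" "K-lipschitz_on D g" "g ` D \<subseteq> E"
  shows "lip_on M (L * K) D (\<lambda>x. F (g x))"
proof (rule lip_onI)
  show "0 \<le> L * K" using assms lip_on_nonneg lipschitz_on_nonneg by (metis mult_nonneg_nonneg)
  fix x y assume xy: "x \<in> D" "y \<in> D"
  show "F (g x) \<in> mspace M" using assms xy lip_on_mspace by blast
  have "mdist M (F (g x)) (F (g y)) \<le> L * dist (g x) (g y)"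
    using assms xy by (intro lip_onD[OF assms(1)]) auto
  also have "\<dots> \<le> L * (K * dist x y)"
    using assms xy by (intro mult_left_mono lipschitz_onD[OF assms(2)]) (auto simp: lip_on_nonneg)
  finally show "mdist M (F (g x)) (F (g y)) \<le> L * K * dist x y" by (simp add: mult.assoc)
qed

lemma lip_on_join:
  fixes a b c :: real
  assumes 1: "lip_on M L {a..b} F" and 2: "lip_on M L {b..c} F" and abc: "a \<le> b" "b \<le> c"
  shows "lip_on M L {a..c} F"
proof -
  have L: "0 \<le> L" using 1 lip_on_nonneg by blast
  have sp: "F x \<in> mspace M" if "x \<in> {a..c}" for x
    using that 1 2 by (cases "x \<le> b") (auto simp: lip_on_def)
  have less: "mdist M (F x) (F y) \<le> L * dist x y" if "x \<in> {a..c}" "y \<in> {a..c}" "x \<le> y" for x y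
  proof (cases "y \<le> b \<or> b \<le> x")
    case True then show ?thesis using that lip_onD[OF 1, of x y] lip_onD[OF 2, of x y] by auto
  next
    case False
    then have "mdist M (F x) (F y) \<le> mdist M (F x) (F b) + mdist M (F b) (F y)"
      using that abc by (intro mdist_triangle sp) auto
    also have "\<dots> \<le> L * dist x b + L * dist b y"
      using False that by (intro add_mono lip_onD[OF 1] lip_onD[OF 2]) auto
    also have "\<dots> = L * dist x y" using False by (auto simp: dist_real_def algebra_simps)
    finally show ?thesis .
  qed
  show ?thesis
  proof (rule lip_onI[OF L sp])
    fix x y assume "x \<in> {a..c}" "y \<in> {a..c}"
    then show "mdist M (F x) (F y) \<le> L * dist x y"
      using less[of x y] less[of y x] by (cases "x \<le> y") (auto simp: mdist_commute dist_commute)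
  qed
qed

lemma lip_path_iff: "lip_path M \<gamma> \<longleftrightarrow> (\<exists>L. lip_on M L {0..1} \<gamma>)"
proof
  assume "lip_path M \<gamma>"
  then obtain B where "B > 0" "\<gamma> \<in> {0..1} \<rightarrow> mspace M"
     "\<forall>x\<in>{0..1}. \<forall>y\<in>{0..1}. mdist M (\<gamma> x) (\<gamma> y) \<le> B * dist x y"
    unfolding lip_path_def Lipschitz_continuous_map_pos interval_metric_def by auto
  then show "\<exists>L. lip_on M L {0..1} \<gamma>" unfolding lip_on_def by (intro exI[of _ B]) auto
next
  assume "\<exists>L. lip_on M L {0..1} \<gamma>"
  then show "lip_path M \<gamma>"
    unfolding lip_path_def Lipschitz_continuous_map_def interval_metric_def lip_on_def by auto
qed

lemma lip_path_mspace: "lip_path M \<gamma> \<Longrightarrow> t \<in> {0..1} \<Longrightarrow> \<gamma> t \<in> mspace M"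
  using lip_on_mspace by (metis lip_path_iff)

lemma lip_path_const: "p \<in> mspace M \<Longrightarrow> lip_path M (\<lambda>_. p)"
  using lip_on_const[of p M 0] by (auto simp: lip_path_iff)

lemma lip_on_inverse_path:
  assumes "lip_on M L {0..1} \<gamma>"
  shows "lip_on M L {0..1} (inverse_path \<gamma>)"
proof -
  have "1-lipschitz_on {0..1} (\<lambda>t::real. 1 - t)" by (auto simp: lipschitz_on_def dist_real_def)
  from lip_on_compose[OF assms this] show ?thesis by (auto simp: inverse_path_def)
qed

lemma concat_path_left: "t \<le> 1/2 \<Longrightarrow> concat_path a b t = a (2 * t)"
  by (simp add: concat_path_def)

lemma concat_path_right:
  assumes "a 1 = b 0" "1/2 \<le> t"
  shows "concat_path a b t = b (2 * t - 1)"
proof (cases "1/2 < t")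
  case False
  then have "2 * t = 1" using assms by linarith
  then have "a (2 * t) = b (2 * t - 1)" using assms(1) by (metis diff_self)
  with False show ?thesis by (simp add: concat_path_def)
qed (simp add: concat_path_def)

lemma lip_on_concat_path:
  assumes a: "lip_on M L {0..1} a" and b: "lip_on M L {0..1} b" and ab: "a 1 = b 0"
  shows "lip_on M (2 * L) {0..1} (concat_path a b)"
proof (rule lip_on_join[where a = 0 and b = "1/2" and c = 1])
  have "lip_on M (L * 2) {0..1/2} (\<lambda>t. a (2 * t))"
  proof (rule lip_on_compose[OF a lipschitz_onI])
    show "dist (2 * x) (2 * y) \<le> 2 * dist x y" for x y :: real
      unfolding dist_real_def by (auto simp: abs_if)
  qed auto
  then show "lip_on M (2 * L) {0..1/2} (concat_path a b)"
    by (subst lip_on_cong[where G = "\<lambda>t. a (2 * t)"]) (auto simp: concat_path_def mult.commute)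
  have "lip_on M (L * 2) {1/2..1} (\<lambda>t. b (2 * t - 1))"
    by (rule lip_on_compose[OF b]) (auto simp: lipschitz_on_def dist_real_def abs_if)
  moreover have "concat_path a b t = b (2 * t - 1)" if "t \<in> {1/2..1}" for t
    using that ab by (intro concat_path_right) auto
  ultimately show "lip_on M (2 * L) {1/2..1} (concat_path a b)"
    by (subst lip_on_cong[where G = "\<lambda>t. b (2 * t - 1)"]) (auto simp: mult.commute)
qed auto

lemma lip_path_inverse_path: "lip_path M \<gamma> \<Longrightarrow> lip_path M (inverse_path \<gamma>)"
  using lip_on_inverse_path by (auto simp: lip_path_iff)

lemma lip_path_concat_path:
  assumes "lip_path M a" "lip_path M b" "a 1 = b 0"
  shows "lip_path M (concat_path a b)"
proof -
  obtain K L where "lip_on M K {0..1} a" "lip_on M L {0..1} b" using assms by (auto simp: lip_path_iff)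
  then have "lip_on M (max K L) {0..1} a" "lip_on M (max K L) {0..1} b"
    by (auto intro: lip_on_mono)
  then show ?thesis using lip_on_concat_path assms(3) by (metis lip_path_iff)
qed

lemma concat_path_ends [simp]: "concat_path a b 0 = a 0" "concat_path a b 1 = b 1"
  by (auto simp: concat_path_def)

lemma inverse_path_ends [simp]: "inverse_path a 0 = a 1" "inverse_path a 1 = a 0"
  by (auto simp: inverse_path_def)

lemma inverse_inverse_path [simp]: "inverse_path (inverse_path a) = a"
  by (auto simp: inverse_path_def)

section \<open>Calculus of Lipschitz homotopies\<close>

text \<open>
  For the \<open>L\<^sup>1\<close> metric on the square, a map is \<open>L\<close>-Lipschitz exactly if it is so in each variable
  separately. Homotopies are therefore handled through their slices, which makes gluing them a
  matter of gluing paths.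
\<close>

definition slice_homotopy ::
    "'a metric \<Rightarrow> real \<Rightarrow> (real \<Rightarrow> 'a) \<Rightarrow> (real \<Rightarrow> 'a) \<Rightarrow> (real \<Rightarrow> real \<Rightarrow> 'a) \<Rightarrow> bool" where
  "slice_homotopy M L a b H \<longleftrightarrow>
     (\<forall>t\<in>{0..1}. lip_on M L {0..1} (\<lambda>s. H s t)) \<and> (\<forall>s\<in>{0..1}. lip_on M L {0..1} (H s)) \<and>
     (\<forall>s\<in>{0..1}. H s 0 = a s \<and> H s 1 = b s) \<and> (\<forall>t\<in>{0..1}. H 0 t = a 0 \<and> H 1 t = a 1)"

lemma slice_homotopy_mono: "slice_homotopy M L a b H \<Longrightarrow> L \<le> K \<Longrightarrow> slice_homotopy M K a b H"
  unfolding slice_homotopy_def using lip_on_mono by blast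

lemma slice_homotopy_lip_on:
  assumes "slice_homotopy M L a b H"
  shows "lip_on M L {0..1} a" "lip_on M L {0..1} b" "a 0 = b 0" "a 1 = b 1"
proof -
  have "lip_on M L {0..1} (\<lambda>s. H s 0)" "lip_on M L {0..1} (\<lambda>s. H s 1)"
    using assms by (simp_all add: slice_homotopy_def)
  moreover have "H s 0 = a s" "H s 1 = b s" if "s \<in> {0..1}" for s
    using assms that by (simp_all add: slice_homotopy_def)
  ultimately show "lip_on M L {0..1} a" "lip_on M L {0..1} b"
    using lip_on_cong[of "{0..1}" "\<lambda>s. H s 0" a] lip_on_cong[of "{0..1}" "\<lambda>s. H s 1" b] by metis+
  show "a 0 = b 0" "a 1 = b 1"
    using assms unfolding slice_homotopy_def by (metis atLeastAtMost_iff order_refl zero_le_one)+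
qed

lemma slice_homotopy_of_square:
  assumes "\<And>p. p \<in> {0..1} \<times> {0..1} \<Longrightarrow> h p \<in> mspace M" "0 \<le> L"
    "\<And>p q. p \<in> {0..1} \<times> {0..1} \<Longrightarrow> q \<in> {0..1} \<times> {0..1} \<Longrightarrow>
       mdist M (h p) (h q) \<le> L * mdist square_metric p q"
    "lip_homotopy M a b h"
  shows "slice_homotopy M L a b (\<lambda>s t. h (s, t))"
  unfolding slice_homotopy_def
proof (intro conjI ballI)
  fix u :: real assume u: "u \<in> {0..1}"
  show "lip_on M L {0..1} (\<lambda>s. h (s, u))"
    using assms(1,2) u assms(3)[of "(s, u)" "(s', u)" for s s'] by (auto simp: lip_on_def dist_real_def)
  show "lip_on M L {0..1} (\<lambda>t. h (u, t))"
    using assms(1,2) u assms(3)[of "(u, s)" "(u, s')" for s s'] by (auto simp: lip_on_def dist_real_def)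
qed (use assms(4) in \<open>auto simp: lip_homotopy_def\<close>)

lemma lip_homotopicI:
  assumes "slice_homotopy M L a b H"
  shows "lip_homotopic M a b"
proof -
  let ?h = "\<lambda>p. H (fst p) (snd p)"
  have 1: "lip_on M L {0..1} (\<lambda>s. H s t)" "lip_on M L {0..1} (H t)" if "t \<in> {0..1}" for t
    using assms that by (auto simp: slice_homotopy_def)
  have "mdist M (?h p) (?h q) \<le> L * mdist square_metric p q"
    if "p \<in> mspace square_metric" "q \<in> mspace square_metric" for p q
  proof -
    have pq: "fst p \<in> {0..1}" "snd p \<in> {0..1}" "fst q \<in> {0..1}" "snd q \<in> {0..1}" using that by auto
    have "mdist M (?h p) (?h q) \<le>
        mdist M (?h p) (H (fst q) (snd p)) + mdist M (H (fst q) (snd p)) (?h q)"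
      using pq by (intro mdist_triangle) (auto intro: lip_on_mspace[OF 1(1)])
    also have "\<dots> \<le> L * dist (fst p) (fst q) + L * dist (snd p) (snd q)"
      using pq by (intro add_mono lip_onD[OF 1(1)] lip_onD[OF 1(2)]) auto
    finally show ?thesis by (simp add: dist_real_def algebra_simps)
  qed
  moreover have "?h \<in> mspace square_metric \<rightarrow> mspace M" using 1 lip_on_mspace by fastforce
  ultimately have "Lipschitz_continuous_map square_metric M ?h"
    unfolding Lipschitz_continuous_map_def by blast
  then have "lip_homotopy M a b ?h"
    using assms unfolding lip_homotopy_def slice_homotopy_def by simp
  then show ?thesis
    using slice_homotopy_lip_on[OF assms] unfolding lip_homotopic_def lip_path_iff by blast
qed

lemma lip_homotopicE:
  assumes "lip_homotopic M a b"
  obtains L H where "slice_homotopy M L a b H"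
proof -
  obtain h where h: "lip_homotopy M a b h" using assms lip_homotopic_def by metis
  then obtain B where "B > 0" "h \<in> mspace square_metric \<rightarrow> mspace M"
      "\<forall>p\<in>mspace square_metric. \<forall>q\<in>mspace square_metric. mdist M (h p) (h q) \<le> B * mdist square_metric p q"
    unfolding lip_homotopy_def Lipschitz_continuous_map_pos by blast
  then show thesis
    by (intro that[OF slice_homotopy_of_square[where L = B and h = h]]) (use h in auto)
qed

lemma lip_homotopic_ends: "lip_homotopic M a b \<Longrightarrow> a 0 = b 0" "lip_homotopic M a b \<Longrightarrow> a 1 = b 1"
  and lip_homotopic_lip_path: "lip_homotopic M a b \<Longrightarrow> lip_path M a" "lip_homotopic M a b \<Longrightarrow> lip_path M b"
  by (simp_all add: lip_homotopic_def)

lemma lip_homotopic_sym: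
  assumes "lip_homotopic M a b"
  shows "lip_homotopic M b a"
proof -
  obtain L H where H: "slice_homotopy M L a b H" using assms lip_homotopicE by blast
  have "lip_on M L {0..1} (\<lambda>t. H s (1 - t))" if "s \<in> {0..1}" for s
    using H that lip_on_inverse_path[of M L "H s"] by (auto simp: slice_homotopy_def inverse_path_def)
  then have "slice_homotopy M L b a (\<lambda>s t. H s (1 - t))"
    using H slice_homotopy_lip_on[OF H] by (auto simp: slice_homotopy_def)
  then show ?thesis by (rule lip_homotopicI)
qed

lemma lip_homotopic_trans [trans]:
  assumes "lip_homotopic M a b" "lip_homotopic M b c"
  shows "lip_homotopic M a c"
proof -
  obtain L1 H1 L2 H2 where "slice_homotopy M L1 a b H1" "slice_homotopy M L2 b c H2"
    using assms lip_homotopicE by metis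
  then have H1: "slice_homotopy M (max L1 L2) a b H1" and H2: "slice_homotopy M (max L1 L2) b c H2"
    by (auto intro: slice_homotopy_mono)
  define L where "L = max L1 L2"
  have L: "0 \<le> L" using slice_homotopy_lip_on(1)[OF H1] lip_on_nonneg L_def by blast
  have "lip_on M (2 * L) {0..1} (concat_path (H1 s) (H2 s))" if "s \<in> {0..1}" for s
    using H1 H2 that by (intro lip_on_concat_path) (auto simp: slice_homotopy_def L_def)
  moreover have "lip_on M (2 * L) {0..1} (\<lambda>s. concat_path (H1 s) (H2 s) t)" if "t \<in> {0..1}" for t
  proof -
    have "lip_on M L {0..1} (\<lambda>s. concat_path (H1 s) (H2 s) t)"
      using H1 H2 that by (cases "t \<le> 1/2") (auto simp: slice_homotopy_def concat_path_def L_def)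
    then show ?thesis using L lip_on_mono by fastforce
  qed
  moreover have "concat_path (H1 0) (H2 0) t = a 0 \<and> concat_path (H1 1) (H2 1) t = a 1" if "t \<in> {0..1}" for t
    using H1 H2 that slice_homotopy_lip_on[OF H1]
    by (cases "t \<le> 1/2") (auto simp: concat_path_def slice_homotopy_def)
  ultimately have "slice_homotopy M (2 * L) a c (\<lambda>s. concat_path (H1 s) (H2 s))"
    using H1 H2 by (auto simp: slice_homotopy_def)
  then show ?thesis by (rule lip_homotopicI)
qed

lemma lip_homotopic_concat_path:
  assumes "lip_homotopic M a a'" "lip_homotopic M b b'" and ab: "a 1 = b 0"
  shows "lip_homotopic M (concat_path a b) (concat_path a' b')"
proof -
  obtain L1 H1 L2 H2 where "slice_homotopy M L1 a a' H1" "slice_homotopy M L2 b b' H2"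
    using assms lip_homotopicE by metis
  then have H1: "slice_homotopy M (max L1 L2) a a' H1" and H2: "slice_homotopy M (max L1 L2) b b' H2"
    by (auto intro: slice_homotopy_mono)
  define L where "L = max L1 L2"
  define H where "H = (\<lambda>s t. concat_path (\<lambda>s. H1 s t) (\<lambda>s. H2 s t) s)"
  have L: "0 \<le> L" using slice_homotopy_lip_on(1)[OF H1] lip_on_nonneg L_def by blast
  have "lip_on M (2 * L) {0..1} (\<lambda>s. H s t)" if "t \<in> {0..1}" for t
    unfolding H_def
    using H1 H2 that ab by (intro lip_on_concat_path) (auto simp: slice_homotopy_def L_def)
  moreover have "lip_on M (2 * L) {0..1} (H s)" if "s \<in> {0..1}" for s
  proof -
    have "lip_on M L {0..1} (H s)"
      using H1 H2 that by (cases "s \<le> 1/2") (auto simp: slice_homotopy_def concat_path_def L_def H_def)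
    then show ?thesis using L lip_on_mono by fastforce
  qed
  ultimately have "slice_homotopy M (2 * L) (concat_path a b) (concat_path a' b') H"
    using H1 H2 unfolding slice_homotopy_def by (auto simp: concat_path_def H_def)
  then show ?thesis by (rule lip_homotopicI)
qed

text \<open>
  Straight-line homotopies inside a convex parameter domain. Reparametrizations of a path, and hence
  all groupoid laws of concatenation, are instances with the domain \<open>{0..1}\<close>; concatenations of
  images of segments are instances with the domain an interval or a square.
\<close>

lemma lip_homotopic_straight:
  fixes F :: "'b::real_normed_vector \<Rightarrow> 'a"
  assumes F: "lip_on M L D F" and D: "convex D"
    and \<phi>: "K-lipschitz_on {0..1} \<phi>" "\<phi> ` {0..1} \<subseteq> D"
    and \<psi>: "K'-lipschitz_on {0..1} \<psi>" "\<psi> ` {0..1} \<subseteq> D"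
    and ends: "\<phi> 0 = \<psi> 0" "\<phi> 1 = \<psi> (1::real)"
  shows "lip_homotopic M (\<lambda>t. F (\<phi> t)) (\<lambda>t. F (\<psi> t))"
proof -
  define G where "G = (\<lambda>s t. (1 - t) *\<^sub>R \<phi> s + t *\<^sub>R \<psi> s)"
  have GD: "G s t \<in> D" if "s \<in> {0..1}" "t \<in> {0..1}" for s t
    using that \<phi>(2) \<psi>(2) D unfolding G_def by (intro convexD) auto
  have K: "0 \<le> K" "0 \<le> K'" using \<phi> \<psi> lipschitz_on_nonneg by blast+
  have G1: "(K + K')-lipschitz_on {0..1} (\<lambda>s. G s t)" if t: "t \<in> {0..1}" for t
  proof -
    have "(\<bar>1 - t\<bar> * K + \<bar>t\<bar> * K')-lipschitz_on {0..1} (\<lambda>s. G s t)"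
      unfolding G_def by (intro lipschitz_on_add lipschitz_on_cmult \<phi> \<psi>)
    moreover have "\<bar>1 - t\<bar> * K + \<bar>t\<bar> * K' \<le> 1 * K + 1 * K'"
      using t K by (intro add_mono mult_right_mono) auto
    ultimately show ?thesis by (auto intro: lipschitz_on_le)
  qed
  have bd: "dist (\<phi> s) (\<psi> s) \<le> K + K'" if s: "s \<in> {0..1}" for s
  proof -
    have "dist (\<phi> s) (\<psi> s) \<le> dist (\<phi> s) (\<phi> 0) + dist (\<psi> 0) (\<psi> s)"
      by (metis dist_triangle ends(1))
    also have "\<dots> \<le> K * dist s 0 + K' * dist 0 s"
      using s by (intro add_mono lipschitz_onD[OF \<phi>(1)] lipschitz_onD[OF \<psi>(1)]) auto
    also have "\<dots> \<le> K * 1 + K' * 1"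
      using s K by (intro add_mono mult_left_mono) auto
    finally show ?thesis by simp
  qed
  have G2: "(K + K')-lipschitz_on {0..1} (G s)" if s: "s \<in> {0..1}" for s
  proof (rule lipschitz_onI)
    fix t t' :: real
    have "G s t - G s t' = (t' - t) *\<^sub>R (\<phi> s - \<psi> s)" by (simp add: G_def algebra_simps)
    then have "dist (G s t) (G s t') = dist t t' * dist (\<phi> s) (\<psi> s)"
      by (simp add: dist_norm abs_minus_commute)
    also have "\<dots> \<le> dist t t' * (K + K')" using bd[OF s] by (intro mult_left_mono) auto
    finally show "dist (G s t) (G s t') \<le> (K + K') * dist t t'" by (simp add: mult.commute)
  qed (use K in auto)
  have "slice_homotopy M (L * (K + K')) (\<lambda>t. F (\<phi> t)) (\<lambda>t. F (\<psi> t)) (\<lambda>s t. F (G s t))"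
    unfolding slice_homotopy_def
  proof (intro conjI ballI)
    fix u :: real assume u: "u \<in> {0..1}"
    show "lip_on M (L * (K + K')) {0..1} (\<lambda>s. F (G s u))"
      using u GD by (intro lip_on_compose[OF F] G1) auto
    show "lip_on M (L * (K + K')) {0..1} (\<lambda>t. F (G u t))"
      using u GD by (intro lip_on_compose[OF F] G2) auto
    have "G 0 u = \<phi> 0" "G 1 u = \<phi> 1"
      using ends by (auto simp: G_def scaleR_left_distrib[symmetric])
    then show "F (G 0 u) = F (\<phi> 0)" "F (G 1 u) = F (\<phi> 1)" by auto
  qed (auto simp: G_def)
  then show ?thesis by (rule lip_homotopicI)
qed

lemma lip_homotopic_reparam:
  assumes \<gamma>: "lip_path M \<gamma>"
    and \<phi>: "K-lipschitz_on {0..1} \<phi>" "\<phi> ` {0..1} \<subseteq> {0..1}"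
    and \<psi>: "K'-lipschitz_on {0..1} \<psi>" "\<psi> ` {0..1} \<subseteq> {0..1}"
    and ends: "\<phi> 0 = \<psi> 0" "\<phi> 1 = \<psi> (1::real)"
    and a: "\<And>t. t \<in> {0..1} \<Longrightarrow> a t = \<gamma> (\<phi> t)" and b: "\<And>t. t \<in> {0..1} \<Longrightarrow> b t = \<gamma> (\<psi> t)"
  shows "lip_homotopic M a b"
proof -
  obtain L where "lip_on M L {0..1} \<gamma>" using \<gamma> by (auto simp: lip_path_iff)
  then have "lip_homotopic M (\<lambda>t. \<gamma> (\<phi> t)) (\<lambda>t. \<gamma> (\<psi> t))"
    by (rule lip_homotopic_straight[OF _ _ \<phi> \<psi> ends]) auto
  then obtain L H where "slice_homotopy M L (\<lambda>t. \<gamma> (\<phi> t)) (\<lambda>t. \<gamma> (\<psi> t)) H" by (rule lip_homotopicE)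
  then have "slice_homotopy M L a b H" using a b by (auto simp: slice_homotopy_def)
  then show ?thesis by (rule lip_homotopicI)
qed

lemma lip_homotopic_cong:
  assumes "lip_path M a" "\<And>t. t \<in> {0..1} \<Longrightarrow> a t = b t"
  shows "lip_homotopic M a b"
  by (rule lip_homotopic_reparam[OF assms(1), where \<phi> = "\<lambda>t. t" and \<psi> = "\<lambda>t. t" and K = 1 and K' = 1])
     (use assms(2) in \<open>auto simp: lipschitz_on_def\<close>)

lemma lip_homotopic_refl: "lip_path M a \<Longrightarrow> lip_homotopic M a a"
  by (rule lip_homotopic_cong) auto

text \<open>
  Both bracketings run through the same three paths at different speeds; the change of parameter has
  the increasing slopes \<open>1/2\<close>, \<open>1\<close> and \<open>2\<close>, hence is a maximum of three affine functions.
\<close>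

lemma concat_path_assoc:
  assumes "lip_path M a" "lip_path M b" "lip_path M c" "a 1 = b 0" "b 1 = c 0"
  shows "lip_homotopic M (concat_path a (concat_path b c)) (concat_path (concat_path a b) c)"
proof (rule lip_homotopic_reparam)
  let ?\<phi> = "\<lambda>t::real. max (t / 2) (max (t - 1/4) (2 * t - 1))"
  show "lip_path M (concat_path (concat_path a b) c)" using assms by (simp add: lip_path_concat_path)
  show "2-lipschitz_on {0..1} ?\<phi>" by (auto simp: lipschitz_on_def dist_real_def max_def min_def abs_if)
  show "1-lipschitz_on {0..1} (\<lambda>t::real. t)" by (auto simp: lipschitz_on_def)
  fix t :: real assume "t \<in> {0..1}"
  consider "t \<le> 1/2" | "1/2 \<le> t" "t \<le> 3/4" | "3/4 \<le> t" by linarith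
  then show "concat_path a (concat_path b c) t = concat_path (concat_path a b) c (?\<phi> t)"
  proof cases
    case 1
    then have "?\<phi> t = t / 2" by (auto simp: max_def)
    with 1 show ?thesis by (simp add: concat_path_left)
  next
    case 2
    then have "?\<phi> t = t - 1/4" by (auto simp: max_def)
    moreover have "concat_path a (concat_path b c) t = b (2 * (2 * t - 1))"
      using 2 assms by (simp add: concat_path_left concat_path_right)
    moreover have "concat_path (concat_path a b) c (t - 1/4) = b (2 * (2 * (t - 1/4)) - 1)"
      using 2 assms concat_path_right[of a b "2 * (t - 1/4)"] by (simp add: concat_path_left)
    ultimately show ?thesis by (simp add: algebra_simps)
  next
    case 3
    then have "?\<phi> t = 2 * t - 1" by (auto simp: max_def)
    with 3 assms show ?thesis by (simp add: concat_path_right)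
  qed
qed (auto simp: max_def)

lemma concat_path_const_right:
  assumes "lip_path M a" "p = a 1"
  shows "lip_homotopic M (concat_path a (\<lambda>_. p)) a"
proof (rule lip_homotopic_reparam[OF assms(1), where \<psi> = "\<lambda>t. t" and K' = 1])
  show "2-lipschitz_on {0..1} (\<lambda>t::real. min 1 (2 * t))"
    by (auto simp: lipschitz_on_def dist_real_def max_def min_def abs_if)
  fix t :: real assume "t \<in> {0..1}"
  show "concat_path a (\<lambda>_. p) t = a (min 1 (2 * t))"
    using assms concat_path_right[of "a" "\<lambda>_. p" t]
    by (cases "t \<le> 1/2") (auto simp: concat_path_left min_def)
qed (auto simp: lipschitz_on_def assms)

lemma concat_path_const_left:
  assumes "lip_path M a" "p = a 0"
  shows "lip_homotopic M (concat_path (\<lambda>_. p) a) a"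
proof (rule lip_homotopic_reparam[OF assms(1), where \<psi> = "\<lambda>t. t" and K' = 1])
  show "2-lipschitz_on {0..1} (\<lambda>t::real. max 0 (2 * t - 1))"
    by (auto simp: lipschitz_on_def dist_real_def max_def min_def abs_if)
  fix t :: real assume "t \<in> {0..1}"
  show "concat_path (\<lambda>_. p) a t = a (max 0 (2 * t - 1))"
    using assms concat_path_right[of "\<lambda>_. p" "a" t]
    by (cases "t \<le> 1/2") (auto simp: concat_path_left max_def)
qed (auto simp: lipschitz_on_def assms)

lemma concat_path_inverse_left:
  assumes "lip_path M a"
  shows "lip_homotopic M (concat_path (inverse_path a) a) (\<lambda>_. a 1)"
proof (rule lip_homotopic_reparam[OF assms(1), where \<psi> = "\<lambda>t. 1" and K' = 1])
  show "2-lipschitz_on {0..1} (\<lambda>t::real. \<bar>1 - 2 * t\<bar>)"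
    by (auto simp: lipschitz_on_def dist_real_def max_def min_def abs_if)
  fix t :: real assume "t \<in> {0..1}"
  consider "t < 1/2" | "t = 1/2" | "1/2 < t" by linarith
  then show "concat_path (inverse_path a) a t = a \<bar>1 - 2 * t\<bar>"
    by cases (use assms in \<open>auto simp: concat_path_def inverse_path_def\<close>)
qed (auto simp: lipschitz_on_def)

lemma concat_path_inverse_right:
  assumes "lip_path M a"
  shows "lip_homotopic M (concat_path a (inverse_path a)) (\<lambda>_. a 0)"
  using concat_path_inverse_left[OF lip_path_inverse_path[OF assms]] by simp

lemma concat_path_cancel_left:
  assumes a: "lip_path M a" and b: "lip_path M b" and ab: "a 1 = b 0"
  shows "lip_homotopic M (concat_path (inverse_path a) (concat_path a b)) b"
proof -
  have "lip_homotopic M (concat_path (inverse_path a) (concat_path a b))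
      (concat_path (concat_path (inverse_path a) a) b)"
    using assms by (intro concat_path_assoc) (auto intro: lip_path_inverse_path)
  also have "lip_homotopic M \<dots> (concat_path (\<lambda>_. a 1) b)"
    using assms by (intro lip_homotopic_concat_path concat_path_inverse_left lip_homotopic_refl) auto
  also have "lip_homotopic M \<dots> b" using b ab by (intro concat_path_const_left) auto
  finally show ?thesis .
qed

lemma concat_path_inverse_cancel_left:
  assumes a: "lip_path M a" and b: "lip_path M b" and ab: "a 0 = b 0"
  shows "lip_homotopic M (concat_path a (concat_path (inverse_path a) b)) b"
  using concat_path_cancel_left[OF lip_path_inverse_path[OF a] b] ab by simp

lemma path_class_eq_iff:
  assumes "lip_path M a"
  shows "path_class M a = path_class M b \<longleftrightarrow> lip_homotopic M a b"
proof
  assume "path_class M a = path_class M b"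
  then have "a \<in> path_class M b" using assms lip_homotopic_refl by (auto simp: path_class_def)
  then show "lip_homotopic M a b" by (simp add: path_class_def lip_homotopic_sym)
next
  assume "lip_homotopic M a b"
  then show "path_class M a = path_class M b"
    unfolding path_class_def using lip_homotopic_sym lip_homotopic_trans by blast
qed

lemma path_class_self: "lip_path M a \<Longrightarrow> a \<in> path_class M a"
  by (simp add: path_class_def lip_homotopic_refl)

section \<open>Length\<close>

definition is_partition :: "real \<Rightarrow> real \<Rightarrow> nat \<Rightarrow> (nat \<Rightarrow> real) \<Rightarrow> bool" where
  "is_partition a b n t \<longleftrightarrow> t 0 = a \<and> t n = b \<and> (\<forall>i<n. t i \<le> t (Suc i))"

definition partition_sum :: "'a metric \<Rightarrow> (real \<Rightarrow> 'a) \<Rightarrow> nat \<Rightarrow> (nat \<Rightarrow> real) \<Rightarrow> real" where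
  "partition_sum M \<gamma> n t = (\<Sum>i<n. mdist M (\<gamma> (t i)) (\<gamma> (t (Suc i))))"

lemma length_on_alt: "length_on M a b \<gamma> = Sup {partition_sum M \<gamma> n t | n t. is_partition a b n t}"
  by (simp add: length_on_def partition_sum_def is_partition_def)

lemma is_partition_mono:
  assumes "is_partition a b n t" "i \<le> j" "j \<le> n"
  shows "t i \<le> t j"
  using assms(2,3)
proof (induction j)
  case (Suc j)
  then show ?case using assms(1) unfolding is_partition_def
    by (metis Suc_le_lessD le_SucE order.trans order_refl Suc_leD)
qed simp

lemma is_partition_range:
  assumes "is_partition a b n t" "i \<le> n"
  shows "t i \<in> {a..b}"
  using is_partition_mono[OF assms(1), of 0 i] is_partition_mono[OF assms(1), of i n] assms
  by (auto simp: is_partition_def)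

lemma is_partition_trivial: "a \<le> b \<Longrightarrow> is_partition a b 1 (\<lambda>i. if i = 0 then a else b)"
  by (auto simp: is_partition_def)

lemma partition_sum_le_lip:
  assumes \<gamma>: "lip_on M L {a..b} \<gamma>" and t: "is_partition a b n t"
  shows "partition_sum M \<gamma> n t \<le> L * (b - a)"
proof -
  have "partition_sum M \<gamma> n t \<le> (\<Sum>i<n. L * (t (Suc i) - t i))"
    unfolding partition_sum_def
  proof (rule sum_mono)
    fix i assume i: "i \<in> {..<n}"
    have "mdist M (\<gamma> (t i)) (\<gamma> (t (Suc i))) \<le> L * dist (t i) (t (Suc i))"
      using i by (intro lip_onD[OF \<gamma>] is_partition_range[OF t]) auto
    also have "dist (t i) (t (Suc i)) = t (Suc i) - t i"
      using is_partition_mono[OF t, of i "Suc i"] i by (simp add: dist_real_def)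
    finally show "mdist M (\<gamma> (t i)) (\<gamma> (t (Suc i))) \<le> L * (t (Suc i) - t i)" .
  qed
  also have "\<dots> = L * (b - a)"
    using t by (simp add: sum_distrib_left[symmetric] sum_lessThan_telescope is_partition_def)
  finally show ?thesis .
qed

lemma partition_sum_le_length_on:
  assumes \<gamma>: "lip_on M L {a..b} \<gamma>" and t: "is_partition a b n t"
  shows "partition_sum M \<gamma> n t \<le> length_on M a b \<gamma>"
  unfolding length_on_alt
proof (rule cSup_upper)
  show "bdd_above {partition_sum M \<gamma> n t | n t. is_partition a b n t}"
    using partition_sum_le_lip[OF \<gamma>] by (intro bdd_aboveI[of _ "L * (b - a)"]) auto
qed (use t in blast)

lemma length_on_le:
  assumes "a \<le> b" "\<And>n t. is_partition a b n t \<Longrightarrow> partition_sum M \<gamma> n t \<le> B"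
  shows "length_on M a b \<gamma> \<le> B"
  unfolding length_on_alt
proof (rule cSup_least)
  show "{partition_sum M \<gamma> n t | n t. is_partition a b n t} \<noteq> {}"
    using is_partition_trivial[OF assms(1)] by blast
qed (use assms(2) in blast)

lemma length_on_le_lip:
  assumes "a \<le> b" "lip_on M L {a..b} \<gamma>"
  shows "length_on M a b \<gamma> \<le> L * (b - a)"
  using assms partition_sum_le_lip by (intro length_on_le) auto

lemma mdist_le_length_on:
  assumes "a \<le> b" "lip_on M L {a..b} \<gamma>"
  shows "mdist M (\<gamma> a) (\<gamma> b) \<le> length_on M a b \<gamma>"
  using partition_sum_le_length_on[OF assms(2) is_partition_trivial[OF assms(1)]]
  by (simp add: partition_sum_def)

lemma length_on_nonneg:
  assumes "a \<le> b" "lip_on M L {a..b} \<gamma>"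
  shows "0 \<le> length_on M a b \<gamma>"
  by (rule order_trans[OF mdist_nonneg mdist_le_length_on[OF assms]])

lemma length_on_cong:
  assumes "\<And>t. t \<in> {a..b} \<Longrightarrow> \<gamma> t = \<delta> t"
  shows "length_on M a b \<gamma> = length_on M a b \<delta>"
proof -
  have "partition_sum M \<gamma> n t = partition_sum M \<delta> n t" if "is_partition a b n t" for n t
    unfolding partition_sum_def
    by (rule sum.cong) (use assms is_partition_range[OF that] in auto)
  then have "{partition_sum M \<gamma> n t | n t. is_partition a b n t} = {partition_sum M \<delta> n t | n t. is_partition a b n t}"
    by metis
  then show ?thesis by (simp add: length_on_alt)
qed

text \<open>
  Clamping a partition of \<open>{a..c}\<close> from above and from below at \<open>b\<close> gives partitions of \<open>{a..b}\<close>
  and of \<open>{b..c}\<close> with the same number of steps, so that no partition point has to be inserted.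
\<close>

lemma length_on_split_le:
  assumes abc: "a \<le> b" "b \<le> c" and \<gamma>: "lip_on M L {a..c} \<gamma>"
  shows "length_on M a c \<gamma> \<le> length_on M a b \<gamma> + length_on M b c \<gamma>"
proof (rule length_on_le)
  fix n t assume t: "is_partition a c n t"
  let ?u = "\<lambda>i. min (t i) b" and ?v = "\<lambda>i. max (t i) b"
  have u: "is_partition a b n ?u" and v: "is_partition b c n ?v"
    using t abc by (auto simp: is_partition_def)
  have "partition_sum M \<gamma> n t \<le> partition_sum M \<gamma> n ?u + partition_sum M \<gamma> n ?v"
    unfolding partition_sum_def sum.distrib[symmetric]
  proof (rule sum_mono)
    fix i assume i: "i \<in> {..<n}"
    have r: "\<gamma> (t i) \<in> mspace M" "\<gamma> (t (Suc i)) \<in> mspace M" "\<gamma> b \<in> mspace M"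
      using i abc is_partition_range[OF t, of i] is_partition_range[OF t, of "Suc i"]
      by (auto intro!: lip_on_mspace[OF \<gamma>])
    have "t i \<le> t (Suc i)" using i t by (simp add: is_partition_def)
    then consider "t (Suc i) \<le> b" "t i \<le> b" | "b < t i" "b < t (Suc i)" | "t i \<le> b" "b < t (Suc i)"
      by linarith
    then show "mdist M (\<gamma> (t i)) (\<gamma> (t (Suc i))) \<le>
       mdist M (\<gamma> (?u i)) (\<gamma> (?u (Suc i))) + mdist M (\<gamma> (?v i)) (\<gamma> (?v (Suc i)))"
      using r mdist_triangle[of "\<gamma> (t i)" M "\<gamma> b" "\<gamma> (t (Suc i))"] by cases (auto simp: min_def max_def)
  qed
  also have "\<dots> \<le> length_on M a b \<gamma> + length_on M b c \<gamma>"
    using abc partition_sum_le_length_on[OF lip_on_mono[OF \<gamma> _ order_refl] u]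
      partition_sum_le_length_on[OF lip_on_mono[OF \<gamma> _ order_refl] v] by (intro add_mono) auto
  finally show "partition_sum M \<gamma> n t \<le> length_on M a b \<gamma> + length_on M b c \<gamma>" .
qed (use abc in simp)

lemma length_on_split_ge:
  assumes abc: "a \<le> b" "b \<le> c" and \<gamma>: "lip_on M L {a..c} \<gamma>"
  shows "length_on M a b \<gamma> + length_on M b c \<gamma> \<le> length_on M a c \<gamma>"
proof -
  have *: "partition_sum M \<gamma> n t + partition_sum M \<gamma> m u \<le> length_on M a c \<gamma>"
    if t: "is_partition a b n t" and u: "is_partition b c m u" for n t m u
  proof -
    define w where "w = (\<lambda>i. if i \<le> n then t i else u (i - n))"
    have wn: "w (n + i) = u i" for i using t u by (cases i) (auto simp: w_def is_partition_def)
    have "w i \<le> w (Suc i)" if i: "i < n + m" for i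
    proof (cases "i < n")
      case True then show ?thesis using t by (simp add: w_def is_partition_def)
    next
      case False
      then obtain k where k: "i = n + k" by (metis add_diff_inverse_nat)
      then show ?thesis using wn[of k] wn[of "Suc k"] u i by (simp add: is_partition_def)
    qed
    then have w: "is_partition a c (n + m) w"
      using t u wn[of m] by (auto simp: is_partition_def w_def)
    have "partition_sum M \<gamma> (n + k) w = partition_sum M \<gamma> n t + partition_sum M \<gamma> k u" for k
    proof (induction k)
      case 0
      show ?case unfolding partition_sum_def by (auto intro!: sum.cong simp: w_def)
    next
      case (Suc k)
      then show ?case using wn[of k] wn[of "Suc k"] by (simp add: partition_sum_def)
    qed
    then show ?thesis using partition_sum_le_length_on[OF \<gamma> w] by metis
  qed
  have "length_on M a b \<gamma> \<le> length_on M a c \<gamma> - partition_sum M \<gamma> m u" if "is_partition b c m u" for m u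
    using abc *[OF _ that] by (intro length_on_le) (auto simp: le_diff_eq)
  then have "length_on M b c \<gamma> \<le> length_on M a c \<gamma> - length_on M a b \<gamma>"
    using abc by (intro length_on_le) (auto simp: algebra_simps)
  then show ?thesis by simp
qed

lemma length_on_split:
  assumes "a \<le> b" "b \<le> c" "lip_on M L {a..c} \<gamma>"
  shows "length_on M a c \<gamma> = length_on M a b \<gamma> + length_on M b c \<gamma>"
  using length_on_split_le[OF assms] length_on_split_ge[OF assms] by simp

lemma length_on_reparam_le:
  assumes \<gamma>: "lip_on M L {\<phi> a..\<phi> b} \<gamma>" and ab: "a \<le> b"
    and mono: "\<And>s t. s \<in> {a..b} \<Longrightarrow> t \<in> {a..b} \<Longrightarrow> s \<le> t \<Longrightarrow> \<phi> s \<le> \<phi> t"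
  shows "length_on M a b (\<lambda>t. \<gamma> (\<phi> t)) \<le> length_on M (\<phi> a) (\<phi> b) \<gamma>"
proof (rule length_on_le[OF ab])
  fix n t assume t: "is_partition a b n t"
  have "is_partition (\<phi> a) (\<phi> b) n (\<phi> \<circ> t)"
    using t mono is_partition_range[OF t] unfolding is_partition_def by auto
  from partition_sum_le_length_on[OF \<gamma> this]
  show "partition_sum M (\<lambda>t. \<gamma> (\<phi> t)) n t \<le> length_on M (\<phi> a) (\<phi> b) \<gamma>"
    by (simp add: partition_sum_def)
qed

lemma length_of_inverse_path_le:
  assumes \<gamma>: "lip_path M \<gamma>"
  shows "length_of M (inverse_path \<gamma>) \<le> length_of M \<gamma>"
proof (rule length_on_le)
  obtain L where L: "lip_on M L {0..1} \<gamma>" using \<gamma> by (auto simp: lip_path_iff)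
  fix n t assume t: "is_partition 0 1 n t"
  let ?u = "\<lambda>i. 1 - t (n - i)"
  have u: "is_partition 0 1 n ?u"
    unfolding is_partition_def
  proof (intro conjI allI impI)
    fix i assume i: "i < n"
    then show "?u i \<le> ?u (Suc i)" using is_partition_mono[OF t, of "n - Suc i" "n - i"] by simp
  qed (use t in \<open>auto simp: is_partition_def\<close>)
  have "partition_sum M (inverse_path \<gamma>) n t
      = (\<Sum>i<n. mdist M (\<gamma> (1 - t (n - Suc i))) (\<gamma> (1 - t (Suc (n - Suc i)))))"
    unfolding partition_sum_def inverse_path_def by (rule sum.nat_diff_reindex[symmetric])
  also have "\<dots> = partition_sum M \<gamma> n ?u"
    unfolding partition_sum_def by (rule sum.cong) (auto simp: mdist_commute Suc_diff_Suc)
  also have "\<dots> \<le> length_of M \<gamma>" by (rule partition_sum_le_length_on[OF L u])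
  finally show "partition_sum M (inverse_path \<gamma>) n t \<le> length_of M \<gamma>" .
qed simp

lemma length_of_concat_path_le:
  assumes "lip_path M a" "lip_path M b" "a 1 = b 0"
  shows "length_of M (concat_path a b) \<le> length_of M a + length_of M b"
proof -
  obtain K L N where K: "lip_on M K {0..1} a" and L: "lip_on M L {0..1} b"
    and N: "lip_on M N {0..1} (concat_path a b)"
    using assms lip_path_concat_path by (metis lip_path_iff)
  have "length_on M 0 (1/2) (concat_path a b) = length_on M 0 (1/2) (\<lambda>t. a (2 * t))"
    by (rule length_on_cong) (auto simp: concat_path_left)
  also have "\<dots> \<le> length_of M a"
    using length_on_reparam_le[of M K "\<lambda>t. 2 * t" 0 "1/2" a] K by simp
  finally have 1: "length_on M 0 (1/2) (concat_path a b) \<le> length_of M a" .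
  have "length_on M (1/2) 1 (concat_path a b) = length_on M (1/2) 1 (\<lambda>t. b (2 * t - 1))"
    by (rule length_on_cong) (auto simp: concat_path_right assms)
  also have "\<dots> \<le> length_of M b"
    using length_on_reparam_le[of M L "\<lambda>t. 2 * t - 1" "1/2" 1 b] L by simp
  finally have 2: "length_on M (1/2) 1 (concat_path a b) \<le> length_of M b" .
  show ?thesis using length_on_split_le[OF _ _ N, of "1/2"] 1 2 by simp
qed

lemma length_of_nonneg: "lip_path M \<beta> \<Longrightarrow> 0 \<le> length_of M \<beta>"
  using length_on_nonneg[of 0 1] by (auto simp: lip_path_iff)

lemma arc_length_parametrized_lip_on:
  assumes \<delta>: "lip_path M \<delta>" and arc: "arc_length_parametrized M 0 1 \<delta>"
  shows "lip_on M (length_of M \<delta>) {0..1} \<delta>"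
proof -
  obtain L where L: "lip_on M L {0..1} \<delta>" using \<delta> lip_path_iff by blast
  have le: "mdist M (\<delta> s) (\<delta> t) \<le> length_of M \<delta> * dist s t" if st: "s \<in> {0..1}" "t \<in> {0..1}" "s \<le> t" for s t
  proof -
    have "mdist M (\<delta> s) (\<delta> t) \<le> length_on M s t \<delta>"
      using st by (intro mdist_le_length_on[OF _ lip_on_mono[OF L _ order_refl]]) auto
    also have "\<dots> = length_of M \<delta> / (1 - 0) * \<bar>s - t\<bar>"
      using arc st unfolding arc_length_parametrized_def by blast
    finally show ?thesis by (simp add: dist_real_def)
  qed
  show ?thesis
  proof (rule lip_onI)
    fix s t :: real assume "s \<in> {0..1}" "t \<in> {0..1}"
    then show "mdist M (\<delta> s) (\<delta> t) \<le> length_of M \<delta> * dist s t"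
      using le[of s t] le[of t s] by (cases "s \<le> t") (auto simp: mdist_commute dist_commute)
  qed (use \<delta> lip_on_mspace[OF L] length_of_nonneg in auto)
qed

text \<open>
  The Lipschitz bound limits the length of each piece to its share, and the pieces add up to the
  total length, so that no piece can be shorter than its share either.
\<close>

lemma arc_length_parametrizedI:
  assumes \<delta>: "lip_on M (length_of M \<delta>) {0..1} \<delta>"
  shows "arc_length_parametrized M 0 1 \<delta>"
proof -
  let ?l = "length_of M \<delta>"
  have le: "length_on M s t \<delta> \<le> ?l * (t - s)" if "0 \<le> s" "s \<le> t" "t \<le> 1" for s t
    using that by (intro length_on_le_lip lip_on_mono[OF \<delta>]) auto
  have eq: "length_on M s t \<delta> = ?l * (t - s)" if st: "0 \<le> s" "s \<le> t" "t \<le> 1" for s t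
  proof -
    have "?l = length_on M 0 s \<delta> + length_on M s 1 \<delta>"
      using st by (intro length_on_split[OF _ _ \<delta>]) auto
    moreover have "length_on M s 1 \<delta> = length_on M s t \<delta> + length_on M t 1 \<delta>"
      using st by (intro length_on_split lip_on_mono[OF \<delta>]) auto
    ultimately have "?l \<le> ?l * (s - 0) + length_on M s t \<delta> + ?l * (1 - t)"
      using le[of 0 s] le[of t 1] st by linarith
    moreover have "?l * (s - 0) + ?l * (t - s) + ?l * (1 - t) = ?l" by (simp add: algebra_simps)
    ultimately show ?thesis using le[OF st] by linarith
  qed
  show ?thesis
    unfolding arc_length_parametrized_def
  proof (intro ballI impI)
    fix s t :: real assume "s \<in> {0..1}" "t \<in> {0..1}" "s \<le> t"
    then show "length_on M s t \<delta> = ?l / (1 - 0) * \<bar>s - t\<bar>" by (subst eq) auto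
  qed
qed

text \<open>
  If \<open>\<beta>\<close> has positive length, its normalized length function is a Lipschitz map of \<open>{0..1}\<close> onto
  itself, and \<open>\<beta>\<close> is constant on the fibres; \<open>\<delta>\<close> is the induced path. Since \<open>\<beta>\<close> is a Lipschitz
  reparametrization of \<open>\<delta>\<close>, the two are homotopic.
\<close>

lemma arc_length_reparametrization:
  assumes \<beta>: "lip_path M \<beta>"
  obtains \<delta> where "lip_homotopic M \<beta> \<delta>" "length_of M \<delta> = length_of M \<beta>"
    "lip_on M (length_of M \<beta>) {0..1} \<delta>"
proof -
  obtain L where L: "lip_on M L {0..1} \<beta>" using \<beta> by (auto simp: lip_path_iff)
  define l where "l = length_of M \<beta>"
  define V where "V = (\<lambda>s. length_on M 0 s \<beta>)"
  have sub: "lip_on M L {s..t} \<beta>" if "0 \<le> s" "t \<le> 1" for s t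
    using that by (intro lip_on_mono[OF L]) auto
  have V: "V t - V s = length_on M s t \<beta>" if "0 \<le> s" "s \<le> t" "t \<le> 1" for s t
    using length_on_split[OF _ _ sub, of 0 s t] that by (simp add: V_def)
  have Vd: "mdist M (\<beta> s) (\<beta> t) \<le> \<bar>V t - V s\<bar>" if "s \<in> {0..1}" "t \<in> {0..1}" for s t
    using that V[of s t] V[of t s] mdist_le_length_on[OF _ sub, of s t] mdist_le_length_on[OF _ sub, of t s]
    by (cases "s \<le> t") (auto simp: mdist_commute)
  have Vm: "V s \<le> V t" if "0 \<le> s" "s \<le> t" "t \<le> 1" for s t
    using V[OF that] length_on_nonneg[OF _ sub, of s t] that by simp
  have V0: "V 0 = 0"
    using length_on_le_lip[OF _ sub, of 0 0] length_on_nonneg[OF _ sub, of 0 0] by (simp add: V_def)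
  have V1: "V 1 = l" by (simp add: V_def l_def)
  have l0: "0 \<le> l" using Vm[of 0 1] V0 V1 by simp
  have Vlip: "L-lipschitz_on {0..1} V"
  proof (rule lipschitz_on_leI)
    fix s t :: real assume "s \<in> {0..1}" "t \<in> {0..1}" "s \<le> t"
    then show "dist (V s) (V t) \<le> L * dist s t"
      using V[of s t] Vm[of s t] length_on_le_lip[OF _ sub, of s t] by (simp add: dist_real_def)
  qed (use lip_on_nonneg[OF L] in auto)
  show thesis
  proof (cases "l = 0")
    case True
    have Vz: "V t = 0" if "t \<in> {0..1}" for t using Vm[of 0 t] Vm[of t 1] that V0 V1 True by simp
    have "mdist M (\<beta> s) (\<beta> t) \<le> 0" if "s \<in> {0..1}" "t \<in> {0..1}" for s t
      using Vd[OF that] Vz[OF that(1)] Vz[OF that(2)] by simp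
    then have "lip_on M l {0..1} \<beta>" using lip_on_mspace[OF L] True by (intro lip_onI) auto
    then show thesis using that lip_homotopic_refl[OF \<beta>] by (auto simp: l_def)
  next
    case False
    with l0 have l: "0 < l" by simp
    have "\<exists>s\<in>{0..1}. V s = l * u" if "u \<in> {0..1}" for u
      using IVT'[of V 0 "l * u" 1] that l V0 V1 lipschitz_on_continuous_on[OF Vlip]
      by (auto simp: mult_left_le)
    then obtain S where S: "\<And>u. u \<in> {0..1} \<Longrightarrow> S u \<in> {0..1} \<and> V (S u) = l * u" by metis
    define \<phi> where "\<phi> = (\<lambda>s. V s / l)"
    define \<delta> where "\<delta> = (\<lambda>u. \<beta> (S u))"
    have \<phi>r: "\<phi> s \<in> {0..1}" if "s \<in> {0..1}" for s
      using that l V0 V1 Vm[of 0 s] Vm[of s 1] by (auto simp: \<phi>_def)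
    have \<phi>m: "\<phi> s \<le> \<phi> t" if "0 \<le> s" "s \<le> t" "t \<le> 1" for s t
      using Vm[OF that] l by (simp add: \<phi>_def divide_right_mono)
    have \<phi>e: "\<phi> 0 = 0" "\<phi> 1 = 1" using V0 V1 l by (auto simp: \<phi>_def)
    have \<delta>: "lip_on M l {0..1} \<delta>"
    proof (rule lip_onI)
      fix u v :: real assume uv: "u \<in> {0..1}" "v \<in> {0..1}"
      show "\<delta> u \<in> mspace M" using S[OF uv(1)] lip_on_mspace[OF L] by (auto simp: \<delta>_def)
      have "mdist M (\<delta> u) (\<delta> v) \<le> \<bar>l * v - l * u\<bar>" using Vd[of "S u" "S v"] S uv by (simp add: \<delta>_def)
      also have "\<dots> = l * dist u v"
        using l by (simp add: dist_real_def abs_minus_commute abs_mult flip: right_diff_distrib)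
      finally show "mdist M (\<delta> u) (\<delta> v) \<le> l * dist u v" .
    qed (use l in simp)
    have \<beta>\<delta>: "\<beta> s = \<delta> (\<phi> s)" if s: "s \<in> {0..1}" for s
    proof -
      have Ss: "S (\<phi> s) \<in> {0..1}" "V (S (\<phi> s)) = V s" using S[OF \<phi>r[OF s]] l by (auto simp: \<phi>_def)
      have "mdist M (\<beta> s) (\<beta> (S (\<phi> s))) \<le> 0" using Vd[OF s Ss(1)] Ss(2) by simp
      then have "mdist M (\<beta> s) (\<beta> (S (\<phi> s))) = 0" by (simp add: order_antisym)
      then show ?thesis using lip_on_mspace[OF L] s Ss by (simp add: \<delta>_def)
    qed
    have "l = length_of M (\<lambda>s. \<delta> (\<phi> s))" unfolding l_def by (rule length_on_cong) (rule \<beta>\<delta>)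
    also have "\<dots> \<le> length_of M \<delta>"
      using length_on_reparam_le[of M l \<phi> 0 1 \<delta>] \<delta> \<phi>m \<phi>e by simp
    finally have "length_of M \<delta> = l" using length_on_le_lip[OF _ \<delta>] by simp
    moreover have "lip_homotopic M \<beta> \<delta>"
    proof (rule lip_homotopic_reparam[where \<gamma> = \<delta> and \<phi> = \<phi> and \<psi> = "\<lambda>t. t" and K' = 1])
      show "(\<bar>1 / l\<bar> * L)-lipschitz_on {0..1} \<phi>"
        using lipschitz_on_cmult_real[OF Vlip, of "1 / l"] by (simp add: \<phi>_def)
    qed (use \<delta> \<beta>\<delta> \<phi>r \<phi>e in \<open>auto simp: lip_path_iff lipschitz_on_def\<close>)
    ultimately show thesis using that \<delta> by (simp add: l_def)
  qed
qed

section \<open>Cluster points of sequences of maps\<close>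

text \<open>
  The product of copies of \<open>{0..1}\<close> is compact by the Tychonoff theorem, and the sets of functions close to
  \<open>\<sigma>\<close> at finitely many points are neighbourhoods of \<open>\<sigma>\<close> in it.
\<close>

lemma unit_valued_cluster_point:
  fixes \<tau> :: "nat \<Rightarrow> 'z \<Rightarrow> real"
  assumes "\<And>N z. \<tau> N z \<in> {0..1}"
  obtains \<sigma> where "\<And>z. \<sigma> z \<in> {0..1}"
    "\<And>F \<epsilon> N0. finite F \<Longrightarrow> \<epsilon> > 0 \<Longrightarrow> \<exists>N\<ge>N0. \<forall>z\<in>F. dist (\<tau> N z) (\<sigma> z) < \<epsilon>"
proof -
  have "compactin (product_topology (\<lambda>_::'z. euclidean) UNIV) (PiE UNIV (\<lambda>_. {0..1::real}))"
    by (simp add: compactin_PiE)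
  then have "compact (PiE UNIV (\<lambda>_::'z. {0..1::real}))"
    by (simp add: euclidean_product_topology)
  moreover have "eventually (\<lambda>f. f \<in> PiE UNIV (\<lambda>_. {0..1})) (filtermap \<tau> sequentially)"
    using assms by (simp add: eventually_filtermap PiE_UNIV_domain)
  moreover have "filtermap \<tau> sequentially \<noteq> bot" by (simp add: filtermap_bot_iff)
  ultimately obtain \<sigma> where \<sigma>: "\<sigma> \<in> PiE UNIV (\<lambda>_. {0..1})" "inf (nhds \<sigma>) (filtermap \<tau> sequentially) \<noteq> bot"
    unfolding compact_filter by blast
  show thesis
  proof
    show "\<sigma> z \<in> {0..1}" for z using \<sigma>(1) by (auto simp: PiE_UNIV_domain)
    fix F :: "'z set" and \<epsilon> :: real and N0 :: nat
    assume F: "finite F" "\<epsilon> > 0"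
    let ?S = "\<Inter>z\<in>F. (\<lambda>f. f z) -` ball (\<sigma> z) \<epsilon>"
    have "open ?S"
      by (intro open_INT F ballI open_vimage open_ball continuous_on_product_coordinates)
    then have nh: "eventually (\<lambda>f. f \<in> ?S) (nhds \<sigma>)"
      using F by (intro eventually_nhds_in_open) auto
    show "\<exists>N\<ge>N0. \<forall>z\<in>F. dist (\<tau> N z) (\<sigma> z) < \<epsilon>"
    proof (rule ccontr)
      assume neg: "\<not> ?thesis"
      have "eventually (\<lambda>f. f \<notin> ?S) (filtermap \<tau> sequentially)"
        unfolding eventually_filtermap eventually_sequentially
        by (rule exI[of _ N0]) (use neg in \<open>auto simp: dist_commute\<close>)
      with nh have "eventually (\<lambda>_. False) (inf (nhds \<sigma>) (filtermap \<tau> sequentially))"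
        unfolding eventually_inf by blast
      then show False using \<sigma>(2) by (simp add: trivial_limit_def)
    qed
  qed
qed

lemma eventually_less_of_null:
  fixes e :: "nat \<Rightarrow> real"
  assumes "e \<longlonglongrightarrow> 0" "\<epsilon> > 0"
  shows "\<exists>N1. \<forall>N\<ge>N1. e N < \<epsilon>"
  using order_tendstoD(2)[OF assms] by (simp add: eventually_sequentially)

text \<open>
  Cluster points for pointwise convergence: closeness is demanded at finitely many points at a time.
  This is enough to inherit Lipschitz bounds, pointwise limits and upper bounds for lengths, as each
  of these concerns finitely many points.
\<close>

definition cluster_map :: "'a metric \<Rightarrow> 'z set \<Rightarrow> (nat \<Rightarrow> 'z \<Rightarrow> 'a) \<Rightarrow> ('z \<Rightarrow> 'a) \<Rightarrow> bool" where
  "cluster_map M Z h H \<longleftrightarrow> (\<forall>z\<in>Z. H z \<in> mspace M) \<and>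
     (\<forall>F \<epsilon> N0. finite F \<longrightarrow> F \<subseteq> Z \<longrightarrow> \<epsilon> > 0 \<longrightarrow> (\<exists>N\<ge>N0. \<forall>z\<in>F. mdist M (h N z) (H z) < \<epsilon>))"

lemma cluster_mapD:
  assumes "cluster_map M Z h H" "finite F" "F \<subseteq> Z" "\<epsilon> > 0"
  obtains N where "N \<ge> N0" "\<And>z. z \<in> F \<Longrightarrow> mdist M (h N z) (H z) < \<epsilon>"
  using assms unfolding cluster_map_def by meson

lemma cluster_map_mspace: "cluster_map M Z h H \<Longrightarrow> z \<in> Z \<Longrightarrow> H z \<in> mspace M"
  by (simp add: cluster_map_def)

text \<open>
  This takes the place of the Arzela-Ascoli theorem. Maps with values near the compact set
  \<open>\<gamma> ` {0..1}\<close> are shadowed by maps that factor through \<open>\<gamma>\<close>, and the choices of parameters,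
  although not continuous in any sense, form a sequence in a product of compact intervals.
\<close>

lemma cluster_map_exists:
  assumes \<gamma>: "lip_path M \<gamma>" and e: "e \<longlonglongrightarrow> 0"
    and h: "\<And>N z. z \<in> Z \<Longrightarrow> h N z \<in> mspace M"
    and near: "\<And>N z. z \<in> Z \<Longrightarrow> \<exists>u\<in>{0..1}. mdist M (h N z) (\<gamma> u) \<le> e N"
  obtains H where "cluster_map M Z h H"
proof -
  obtain L where L: "lip_on M L {0..1} \<gamma>" using \<gamma> by (auto simp: lip_path_iff)
  have "\<exists>u. u \<in> {0..1} \<and> (z \<in> Z \<longrightarrow> mdist M (h N z) (\<gamma> u) \<le> e N)" for N z
    using near[of z N] by (cases "z \<in> Z") (auto intro: exI[of _ "0::real"])
  then have "\<exists>\<tau>. \<forall>N z. \<tau> N z \<in> {0..1} \<and> (z \<in> Z \<longrightarrow> mdist M (h N z) (\<gamma> (\<tau> N z)) \<le> e N)"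
    by (intro choice allI)
  then obtain \<tau> where \<tau>: "\<And>N z. \<tau> N z \<in> {0..1}"
      "\<And>N z. z \<in> Z \<Longrightarrow> mdist M (h N z) (\<gamma> (\<tau> N z)) \<le> e N"
    by blast
  obtain \<sigma> where \<sigma>: "\<And>z. \<sigma> z \<in> {0..1}"
    "\<And>F \<epsilon> N0. finite F \<Longrightarrow> \<epsilon> > 0 \<Longrightarrow> \<exists>N\<ge>N0. \<forall>z\<in>F. dist (\<tau> N z) (\<sigma> z) < \<epsilon>"
    by (rule unit_valued_cluster_point[of \<tau>, OF \<tau>(1)]) (rule that)
  have "cluster_map M Z h (\<lambda>z. \<gamma> (\<sigma> z))"
    unfolding cluster_map_def
  proof (intro conjI ballI allI impI)
    show "\<gamma> (\<sigma> z) \<in> mspace M" for z using \<sigma>(1) lip_on_mspace[OF L] by blast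
    fix F \<epsilon> N0 assume F: "finite F" "F \<subseteq> Z" "(\<epsilon>::real) > 0"
    have L0: "0 \<le> L" using L lip_on_nonneg by blast
    obtain N1 where N1: "\<forall>N\<ge>N1. e N < \<epsilon> / 2"
      using eventually_less_of_null[OF e half_gt_zero[OF F(3)]] by blast
    obtain N where N: "N \<ge> max N0 N1" "\<forall>z\<in>F. dist (\<tau> N z) (\<sigma> z) < \<epsilon> / (2 * (L + 1))"
      using \<sigma>(2)[OF F(1), of "\<epsilon> / (2 * (L + 1))" "max N0 N1"] F(3) L0 by auto
    have "mdist M (h N z) (\<gamma> (\<sigma> z)) < \<epsilon>" if z: "z \<in> F" for z
    proof -
      have "mdist M (h N z) (\<gamma> (\<sigma> z)) \<le> mdist M (h N z) (\<gamma> (\<tau> N z)) + mdist M (\<gamma> (\<tau> N z)) (\<gamma> (\<sigma> z))"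
        using z F h \<tau>(1) \<sigma>(1) by (intro mdist_triangle lip_on_mspace[OF L]) auto
      also have "\<dots> \<le> e N + L * dist (\<tau> N z) (\<sigma> z)"
        using z F \<tau> \<sigma>(1) by (intro add_mono lip_onD[OF L]) auto
      also have "L * dist (\<tau> N z) (\<sigma> z) \<le> L * (\<epsilon> / (2 * (L + 1)))"
        using N z L0 by (intro mult_left_mono) (auto intro: less_imp_le)
      also have "\<dots> \<le> \<epsilon> / 2" using L0 F by (simp add: field_simps)
      also have "e N < \<epsilon> / 2" using N1 N by simp
      finally show ?thesis by simp
    qed
    then show "\<exists>N\<ge>N0. \<forall>z\<in>F. mdist M (h N z) (\<gamma> (\<sigma> z)) < \<epsilon>" using N(1) by auto
  qed
  then show thesis by (rule that)
qed

lemma cluster_map_mdist_le: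
  assumes H: "cluster_map M Z h H" and h: "\<And>N z. z \<in> Z \<Longrightarrow> h N z \<in> mspace M"
    and zw: "z \<in> Z" "w \<in> Z" and B: "\<And>N. mdist M (h N z) (h N w) \<le> B"
  shows "mdist M (H z) (H w) \<le> B"
proof (rule field_le_epsilon)
  fix \<epsilon> :: real assume "\<epsilon> > 0"
  then obtain N where N: "\<And>x. x \<in> {z, w} \<Longrightarrow> mdist M (h N x) (H x) < \<epsilon> / 2"
    using cluster_mapD[OF H, of "{z, w}" "\<epsilon> / 2" 0] zw by auto
  note sp = h cluster_map_mspace[OF H]
  have "mdist M (H z) (H w) \<le> mdist M (H z) (h N z) + mdist M (h N z) (H w)"
    using zw by (intro mdist_triangle sp)
  also have "mdist M (h N z) (H w) \<le> mdist M (h N z) (h N w) + mdist M (h N w) (H w)"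
    using zw by (intro mdist_triangle sp)
  finally show "mdist M (H z) (H w) \<le> B + \<epsilon>"
    using B[of N] N[of z] N[of w] by (simp add: mdist_commute)
qed

lemma cluster_map_eq_limit:
  assumes H: "cluster_map M Z h H" and h: "\<And>N z. z \<in> Z \<Longrightarrow> h N z \<in> mspace M"
    and z: "z \<in> Z" and p: "p \<in> mspace M"
    and e: "e \<longlonglongrightarrow> 0" and lim: "\<And>N. mdist M (h N z) p \<le> e N"
  shows "H z = p"
proof -
  have sp: "H z \<in> mspace M" using H z by (rule cluster_map_mspace)
  have "mdist M (H z) p \<le> 0 + \<epsilon>" if \<epsilon>: "\<epsilon> > 0" for \<epsilon>
  proof -
    obtain N1 where N1: "\<forall>N\<ge>N1. e N < \<epsilon> / 2"
      using eventually_less_of_null[OF e half_gt_zero[OF \<epsilon>]] by blast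
    obtain N where N: "N \<ge> N1" "mdist M (h N z) (H z) < \<epsilon> / 2"
      using cluster_mapD[OF H, of "{z}" "\<epsilon> / 2" N1] z \<epsilon> by auto
    have "mdist M (H z) p \<le> mdist M (H z) (h N z) + mdist M (h N z) p"
      using sp p z h by (intro mdist_triangle)
    then show ?thesis using N N1[rule_format, OF N(1)] lim[of N] by (simp add: mdist_commute)
  qed
  then have "mdist M (H z) p \<le> 0" by (rule field_le_epsilon)
  then have "mdist M (H z) p = 0" by (simp add: order_antisym)
  then show ?thesis using sp p by simp
qed

text \<open>
  Lower semicontinuity of length: a partition has finitely many points, so its sum for \<open>b\<close> is
  approximated by its sums for some of the \<open>\<beta> N\<close>.
\<close>

lemma length_of_cluster_map_le:
  assumes b: "cluster_map M {0..1} \<beta> b" and \<beta>: "\<And>N. lip_path M (\<beta> N)"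
    and e: "e \<longlonglongrightarrow> 0" and len: "\<And>N. length_of M (\<beta> N) \<le> m + e N"
  shows "length_of M b \<le> m"
proof (rule length_on_le)
  fix n t assume t: "is_partition 0 1 n t"
  show "partition_sum M b n t \<le> m"
  proof (rule field_le_epsilon)
    fix \<epsilon> :: real assume \<epsilon>: "\<epsilon> > 0"
    define \<eta> where "\<eta> = \<epsilon> / (4 * (real n + 1))"
    have \<eta>: "\<eta> > 0" using \<epsilon> by (simp add: \<eta>_def)
    obtain N1 where N1: "\<forall>N\<ge>N1. e N < \<epsilon> / 2"
      using eventually_less_of_null[OF e half_gt_zero[OF \<epsilon>]] by blast
    obtain N where N: "N \<ge> N1" "\<And>z. z \<in> t ` {..n} \<Longrightarrow> mdist M (\<beta> N z) (b z) < \<eta>"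
      using cluster_mapD[OF b, of "t ` {..n}" \<eta> N1] is_partition_range[OF t] \<eta> by blast
    obtain L where L: "lip_on M L {0..1} (\<beta> N)" using \<beta> lip_path_iff by blast
    have "partition_sum M b n t \<le> (\<Sum>i<n. mdist M (\<beta> N (t i)) (\<beta> N (t (Suc i))) + 2 * \<eta>)"
      unfolding partition_sum_def
    proof (rule sum_mono)
      fix i assume "i \<in> {..<n}"
      then have i: "t i \<in> {0..1}" "t (Suc i) \<in> {0..1}" "t i \<in> t ` {..n}" "t (Suc i) \<in> t ` {..n}"
        using is_partition_range[OF t] by auto
      note sp = lip_on_mspace[OF L] cluster_map_mspace[OF b]
      have "mdist M (b (t i)) (b (t (Suc i))) \<le> mdist M (b (t i)) (\<beta> N (t i)) + mdist M (\<beta> N (t i)) (b (t (Suc i)))"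
        using i by (intro mdist_triangle sp)
      also have "mdist M (\<beta> N (t i)) (b (t (Suc i))) \<le>
          mdist M (\<beta> N (t i)) (\<beta> N (t (Suc i))) + mdist M (\<beta> N (t (Suc i))) (b (t (Suc i)))"
        using i by (intro mdist_triangle sp)
      finally show "mdist M (b (t i)) (b (t (Suc i))) \<le> mdist M (\<beta> N (t i)) (\<beta> N (t (Suc i))) + 2 * \<eta>"
        using N(2)[OF i(3)] N(2)[OF i(4)] by (simp add: mdist_commute)
    qed
    also have "\<dots> = partition_sum M (\<beta> N) n t + 2 * \<eta> * n"
      by (simp add: partition_sum_def sum.distrib)
    also have "\<dots> \<le> (m + \<epsilon> / 2) + \<epsilon> / 2"
    proof (rule add_mono)
      show "partition_sum M (\<beta> N) n t \<le> m + \<epsilon> / 2"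
        using partition_sum_le_length_on[OF L t] len[of N] N1[rule_format, OF N(1)] by simp
      show "2 * \<eta> * n \<le> \<epsilon> / 2" using \<epsilon> by (simp add: \<eta>_def field_simps)
    qed
    finally show "partition_sum M b n t \<le> m + \<epsilon>" by simp
  qed
qed simp

text \<open>
  The two properties that tree-like homotopies share, a Lipschitz bound and an image inside that of
  the initial path, are what makes a sequence of them cluster at a homotopy. The bottom and the two
  lateral sides converge, hence are determined; the top side is a cluster map of the top sides.
\<close>

lemma slice_homotopy_cluster:
  assumes \<gamma>: "lip_path M \<gamma>" and e: "e \<longlonglongrightarrow> 0"
    and h: "\<And>N. slice_homotopy M L (a N) (b N) (h N)"
    and im: "\<And>N s t. s \<in> {0..1} \<Longrightarrow> t \<in> {0..1} \<Longrightarrow> h N s t \<in> a N ` {0..1}"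
    and a: "\<And>N s. s \<in> {0..1} \<Longrightarrow> mdist M (a N s) (\<gamma> s) \<le> e N"
  obtains H b' where "slice_homotopy M L \<gamma> b' H" "cluster_map M {0..1} b b'"
proof -
  define Z where "Z = {0..1::real} \<times> {0..1::real}"
  define g where "g = (\<lambda>N z. h N (fst z) (snd z))"
  have sl: "lip_on M L {0..1} (\<lambda>s. h N s t)" "lip_on M L {0..1} (h N t)"
    "h N t 0 = a N t" "h N t 1 = b N t" "h N 0 t = a N 0" "h N 1 t = a N 1" if "t \<in> {0..1}" for t N
    using h[of N] that by (auto simp: slice_homotopy_def)
  have gM: "g N z \<in> mspace M" if "z \<in> Z" for N z
    using that lip_on_mspace[OF sl(1)] by (auto simp: Z_def g_def)
  obtain G where G: "cluster_map M Z g G"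
  proof (rule cluster_map_exists[OF \<gamma> e gM])
    fix N z assume "z \<in> Z"
    then have "g N z \<in> a N ` {0..1}" using im by (auto simp: Z_def g_def)
    then show "\<exists>u\<in>{0..1}. mdist M (g N z) (\<gamma> u) \<le> e N" using a by force
  qed
  note le = cluster_map_mdist_le[OF G gM] and lim = cluster_map_eq_limit[OF G gM _ lip_path_mspace[OF \<gamma>] e]
  have L: "0 \<le> L" using sl(1)[of 0] lip_on_nonneg by fastforce
  have "slice_homotopy M L \<gamma> (\<lambda>s. G (s, 1)) (\<lambda>s t. G (s, t))"
    unfolding slice_homotopy_def
  proof (intro conjI ballI)
    fix u :: real assume u: "u \<in> {0..1}"
    show "lip_on M L {0..1} (\<lambda>s. G (s, u))"
    proof (rule lip_onI[OF L])
      fix x y :: real assume xy: "x \<in> {0..1}" "y \<in> {0..1}"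
      show "G (x, u) \<in> mspace M" using cluster_map_mspace[OF G] xy u by (auto simp: Z_def)
      show "mdist M (G (x, u)) (G (y, u)) \<le> L * dist x y"
        by (rule le) (use xy u lip_onD[OF sl(1)[OF u] xy] in \<open>auto simp: Z_def g_def\<close>)
    qed
    show "lip_on M L {0..1} (\<lambda>t. G (u, t))"
    proof (rule lip_onI[OF L])
      fix x y :: real assume xy: "x \<in> {0..1}" "y \<in> {0..1}"
      show "G (u, x) \<in> mspace M" using cluster_map_mspace[OF G] xy u by (auto simp: Z_def)
      show "mdist M (G (u, x)) (G (u, y)) \<le> L * dist x y"
        by (rule le) (use xy u lip_onD[OF sl(2)[OF u] xy] in \<open>auto simp: Z_def g_def\<close>)
    qed
    show "G (u, 0) = \<gamma> u" by (rule lim) (use u a sl in \<open>auto simp: Z_def g_def\<close>)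
    show "G (0, u) = \<gamma> 0" by (rule lim) (use u a sl in \<open>auto simp: Z_def g_def\<close>)
    show "G (1, u) = \<gamma> 1" by (rule lim) (use u a sl in \<open>auto simp: Z_def g_def\<close>)
  qed simp
  moreover have "cluster_map M {0..1} b (\<lambda>s. G (s, 1))"
    unfolding cluster_map_def
  proof (intro conjI ballI allI impI)
    show "G (s, 1) \<in> mspace M" if "s \<in> {0..1}" for s
      using cluster_map_mspace[OF G] that by (auto simp: Z_def)
    fix F :: "real set" and \<epsilon> :: real and N0 :: nat
    assume F: "finite F" "F \<subseteq> {0..1}" "\<epsilon> > 0"
    then have "finite ((\<lambda>s. (s, 1::real)) ` F)" "(\<lambda>s. (s, 1)) ` F \<subseteq> Z" by (auto simp: Z_def)
    then obtain N where N: "N \<ge> N0" "\<And>z. z \<in> (\<lambda>s. (s, 1)) ` F \<Longrightarrow> mdist M (g N z) (G z) < \<epsilon>"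
      using cluster_mapD[OF G _ _ F(3)] by metis
    then have "mdist M (b N s) (G (s, 1)) < \<epsilon>" if "s \<in> F" for s
      using that F sl(4)[of s N] by (force simp: g_def)
    then show "\<exists>N\<ge>N0. \<forall>s\<in>F. mdist M (b N s) (G (s, 1)) < \<epsilon>" using N(1) by blast
  qed
  ultimately show thesis by (rule that)
qed

section \<open>Tree-like homotopy spaces\<close>

lemma lip_const_le:
  assumes "0 \<le> B" "\<And>x y. x \<in> mspace X \<Longrightarrow> y \<in> mspace X \<Longrightarrow> mdist M (f x) (f y) \<le> B * mdist X x y"
  shows "lip_const X M f \<le> B"
  unfolding lip_const_def by (rule cInf_lower) (use assms in \<open>auto intro: bdd_belowI[of _ 0]\<close>)

lemma mdist_le_lip_const:
  assumes f: "Lipschitz_continuous_map X M f" and xy: "x \<in> mspace X" "y \<in> mspace X"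
  shows "mdist M (f x) (f y) \<le> lip_const X M f * mdist X x y"
proof -
  obtain B where B: "B > 0" "\<forall>x\<in>mspace X. \<forall>y\<in>mspace X. mdist M (f x) (f y) \<le> B * mdist X x y"
    using f by (auto simp: Lipschitz_continuous_map_pos)
  show ?thesis
  proof (cases "mdist X x y = 0")
    case True
    then show ?thesis using B xy by force
  next
    case False
    then have pos: "mdist X x y > 0" by (simp add: order_less_le)
    have "mdist M (f x) (f y) / mdist X x y \<le> lip_const X M f"
      unfolding lip_const_def
    proof (rule cInf_greatest)
      show "{B. 0 \<le> B \<and> (\<forall>x\<in>mspace X. \<forall>y\<in>mspace X. mdist M (f x) (f y) \<le> B * mdist X x y)} \<noteq> {}"
        using B less_imp_le by blast
    qed (use xy pos in \<open>auto simp: pos_divide_le_eq\<close>)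
    then show ?thesis using pos by (simp add: pos_divide_le_eq)
  qed
qed

text \<open>
  The least Lipschitz constant of the homotopy is bounded by any Lipschitz constant of \<open>\<gamma>\<close>; in this
  form a bound that is uniform over a sequence of paths carries over to the homotopies.
\<close>

lemma tree_like_homotopyE:
  assumes M: "tree_like_homotopy_space M" and \<gamma>\<beta>: "lip_homotopic M \<gamma> \<beta>" and K: "lip_on M K {0..1} \<gamma>"
  obtains h \<beta>' where "slice_homotopy M K \<gamma> \<beta>' h"
    "\<And>s t. s \<in> {0..1} \<Longrightarrow> t \<in> {0..1} \<Longrightarrow> h s t \<in> \<gamma> ` {0..1}"
    "length_of M \<beta>' \<le> length_of M \<beta>"
    "arc_length_parametrized M 0 1 \<beta> \<Longrightarrow> length_minimizing_in M (path_class M \<gamma>) \<beta> \<Longrightarrow>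
       \<forall>t\<in>{0..1}. \<beta>' t = \<beta> t"
proof -
  obtain H \<beta>' where H: "lip_homotopy M \<gamma> \<beta>' H"
      "lip_const square_metric M H = lip_const interval_metric M \<gamma>"
      "H ` ({0..1} \<times> {0..1}) \<subseteq> \<gamma> ` {0..1}" "length_of M \<beta>' \<le> length_of M \<beta>"
      "arc_length_parametrized M 0 1 \<beta> \<and> length_minimizing_in M (path_class M \<gamma>) \<beta> \<longrightarrow>
         (\<forall>t\<in>{0..1}. \<beta>' t = \<beta> t)"
    using M[unfolded tree_like_homotopy_space_def, rule_format, OF \<gamma>\<beta>] by blast
  have HL: "Lipschitz_continuous_map square_metric M H" using H(1) by (simp add: lip_homotopy_def)
  have K0: "0 \<le> K" using K lip_on_nonneg by blast
  have le: "lip_const square_metric M H \<le> K"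
    unfolding H(2)
    by (rule lip_const_le) (use K in \<open>auto simp: lip_on_def interval_metric_def\<close>)
  have "slice_homotopy M K \<gamma> \<beta>' (\<lambda>s t. H (s, t))"
  proof (rule slice_homotopy_of_square[OF _ K0 _ H(1)])
    fix p q :: "real \<times> real" assume pq: "p \<in> {0..1} \<times> {0..1}" "q \<in> {0..1} \<times> {0..1}"
    show "H p \<in> mspace M" using Lipschitz_continuous_map_image[OF HL] pq(1) by (auto simp: Pi_iff)
    have "mdist M (H p) (H q) \<le> lip_const square_metric M H * mdist square_metric p q"
      using pq by (intro mdist_le_lip_const[OF HL]) auto
    also have "\<dots> \<le> K * mdist square_metric p q" using le by (intro mult_right_mono) auto
    finally show "mdist M (H p) (H q) \<le> K * mdist square_metric p q" .
  qed
  then show thesis by (rule that) (use H in blast)+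
qed

text \<open>
  Homotopies from \<open>\<gamma>\<close> to shorter and shorter paths can be taken with the Lipschitz constant and the
  image of \<open>\<gamma>\<close>; their cluster homotopy ends in a path of least length.
\<close>

theorem arc_length_minimizer_exists:
  assumes M: "tree_like_homotopy_space M" and \<gamma>: "lip_path M \<gamma>"
  obtains \<delta> where "lip_homotopic M \<gamma> \<delta>" "arc_length_parametrized M 0 1 \<delta>"
    "length_minimizing_in M (path_class M \<gamma>) \<delta>"
proof -
  obtain K where K: "lip_on M K {0..1} \<gamma>" using \<gamma> by (auto simp: lip_path_iff)
  define S where "S = {length_of M \<eta> | \<eta>. lip_homotopic M \<gamma> \<eta>}"
  define m where "m = Inf S"
  have "bdd_below S"
  proof (rule bdd_belowI)
    fix x assume "x \<in> S"
    then show "0 \<le> x"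
      using length_on_nonneg[of 0 1 M] by (auto simp: S_def lip_homotopic_def lip_path_iff)
  qed
  then have mle: "m \<le> length_of M \<eta>" if "lip_homotopic M \<gamma> \<eta>" for \<eta>
    unfolding m_def using that by (intro cInf_lower) (auto simp: S_def)
  have "S \<noteq> {}" using lip_homotopic_refl[OF \<gamma>] by (auto simp: S_def)
  then have "\<exists>\<eta>. lip_homotopic M \<gamma> \<eta> \<and> length_of M \<eta> < m + inverse (real (Suc N))" for N
    using cInf_lessD[of S "m + inverse (real (Suc N))"] by (auto simp: S_def m_def)
  then obtain \<eta> where \<eta>: "\<And>N. lip_homotopic M \<gamma> (\<eta> N)"
      "\<And>N. length_of M (\<eta> N) < m + inverse (real (Suc N))" by metis
  have "\<exists>h \<beta>'. slice_homotopy M K \<gamma> \<beta>' h \<and>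
      (\<forall>s\<in>{0..1}. \<forall>t\<in>{0..1}. h s t \<in> \<gamma> ` {0..1}) \<and> length_of M \<beta>' \<le> length_of M (\<eta> N)" for N
    using tree_like_homotopyE[OF M \<eta>(1)[of N] K] by metis
  then obtain h \<beta> where h: "\<And>N. slice_homotopy M K \<gamma> (\<beta> N) (h N)"
      "\<And>N s t. s \<in> {0..1} \<Longrightarrow> t \<in> {0..1} \<Longrightarrow> h N s t \<in> \<gamma> ` {0..1}"
      "\<And>N. length_of M (\<beta> N) \<le> length_of M (\<eta> N)" by metis
  obtain H b where H: "slice_homotopy M K \<gamma> b H" and b: "cluster_map M {0..1} \<beta> b"
  proof (rule slice_homotopy_cluster[OF \<gamma> _ h(1,2)])
    show "(\<lambda>_. 0) \<longlonglongrightarrow> (0::real)" by simp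
    show "mdist M (\<gamma> s) (\<gamma> s) \<le> 0" if "s \<in> {0..1}" for s using lip_on_mspace[OF K that] by simp
  qed
  have \<gamma>b: "lip_homotopic M \<gamma> b" using H by (rule lip_homotopicI)
  have "length_of M b \<le> m"
  proof (rule length_of_cluster_map_le[OF b _ LIMSEQ_inverse_real_of_nat])
    show "lip_path M (\<beta> N)" for N using h(1) lip_homotopicI lip_homotopic_lip_path(2) by blast
    show "length_of M (\<beta> N) \<le> m + inverse (real (Suc N))" for N using h(3)[of N] \<eta>(2)[of N] by simp
  qed
  moreover obtain \<delta> where \<delta>: "lip_homotopic M b \<delta>" "length_of M \<delta> = length_of M b"
      "lip_on M (length_of M b) {0..1} \<delta>"
    using arc_length_reparametrization lip_homotopic_lip_path(2)[OF \<gamma>b] by blast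
  ultimately have \<delta>m: "length_of M \<delta> \<le> m" by simp
  show thesis
  proof
    show \<gamma>\<delta>: "lip_homotopic M \<gamma> \<delta>" using \<gamma>b \<delta>(1) by (rule lip_homotopic_trans)
    show "arc_length_parametrized M 0 1 \<delta>" using \<delta> by (intro arc_length_parametrizedI) simp
    show "length_minimizing_in M (path_class M \<gamma>) \<delta>"
      using \<gamma>\<delta> \<delta>m mle unfolding length_minimizing_in_def path_class_def by force
  qed
qed

section \<open>The universal path space as a metric space\<close>

text \<open>
  \<open>connects M A B \<beta>\<close> says that \<open>B\<close> is the class obtained by continuing \<open>A\<close> along \<open>\<beta>\<close>; the relation
  is a groupoid action of the homotopy classes of paths on the path space.
\<close>

definition connects ::
    "'a metric \<Rightarrow> (real \<Rightarrow> 'a) set \<Rightarrow> (real \<Rightarrow> 'a) set \<Rightarrow> (real \<Rightarrow> 'a) \<Rightarrow> bool" where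
  "connects M A B \<beta> \<longleftrightarrow>
     (\<exists>\<gamma>1\<in>A. \<exists>\<gamma>2\<in>B. lip_homotopic M \<beta> (concat_path (inverse_path \<gamma>1) \<gamma>2))"

text \<open>
  In the fundamental groupoid, \<open>[\<beta>] = [\<gamma>]\<^sup>-\<^sup>1[\<delta>]\<close> amounts to \<open>[\<gamma>][\<beta>] = [\<delta>]\<close>. The second form makes
  continuation along a concatenation of paths a matter of associativity.
\<close>

lemma connects_iff:
  assumes \<gamma>: "lip_path M \<gamma>" and \<delta>: "lip_path M \<delta>" and start: "\<gamma> 0 = \<delta> 0"
  shows "connects M (path_class M \<gamma>) (path_class M \<delta>) \<beta> \<longleftrightarrow>
    lip_path M \<beta> \<and> \<gamma> 1 = \<beta> 0 \<and> lip_homotopic M (concat_path \<gamma> \<beta>) \<delta>"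
proof
  assume "connects M (path_class M \<gamma>) (path_class M \<delta>) \<beta>"
  then obtain \<gamma>' \<delta>' where g: "lip_homotopic M \<gamma> \<gamma>'" and d: "lip_homotopic M \<delta> \<delta>'"
    and b: "lip_homotopic M \<beta> (concat_path (inverse_path \<gamma>') \<delta>')"
    by (auto simp: connects_def path_class_def)
  have ends: "\<gamma>' 0 = \<delta>' 0" "\<gamma> 1 = \<beta> 0"
    using lip_homotopic_ends[OF g] lip_homotopic_ends[OF d] lip_homotopic_ends[OF b] start by auto
  have "lip_homotopic M (concat_path \<gamma> \<beta>) (concat_path \<gamma>' (concat_path (inverse_path \<gamma>') \<delta>'))"
    using g b ends by (intro lip_homotopic_concat_path)
  also have "lip_homotopic M \<dots> \<delta>'"
    using g d ends by (intro concat_path_inverse_cancel_left lip_homotopic_lip_path(2))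
  also have "lip_homotopic M \<delta>' \<delta>" using d by (rule lip_homotopic_sym)
  finally show "lip_path M \<beta> \<and> \<gamma> 1 = \<beta> 0 \<and> lip_homotopic M (concat_path \<gamma> \<beta>) \<delta>"
    using lip_homotopic_lip_path(1)[OF b] ends by simp
next
  assume \<beta>: "lip_path M \<beta> \<and> \<gamma> 1 = \<beta> 0 \<and> lip_homotopic M (concat_path \<gamma> \<beta>) \<delta>"
  have "lip_homotopic M \<beta> (concat_path (inverse_path \<gamma>) (concat_path \<gamma> \<beta>))"
    using \<beta> \<gamma> by (intro lip_homotopic_sym[OF concat_path_cancel_left]) auto
  also have "lip_homotopic M \<dots> (concat_path (inverse_path \<gamma>) \<delta>)"
    using \<beta> \<gamma> by (intro lip_homotopic_concat_path lip_homotopic_refl lip_path_inverse_path) auto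
  finally show "connects M (path_class M \<gamma>) (path_class M \<delta>) \<beta>"
    unfolding connects_def using path_class_self[OF \<gamma>] path_class_self[OF \<delta>] by blast
qed

lemma path_spaceE:
  assumes "A \<in> path_space M p0"
  obtains \<gamma> where "lip_path M \<gamma>" "\<gamma> 0 = p0" "A = path_class M \<gamma>"
  using assms by (auto simp: path_space_def)

lemma path_class_in_path_space: "lip_path M \<gamma> \<Longrightarrow> \<gamma> 0 = p0 \<Longrightarrow> path_class M \<gamma> \<in> path_space M p0"
  by (auto simp: path_space_def)

lemma endpoint_proj_path_class:
  assumes "lip_path M \<gamma>"
  shows "endpoint_proj (path_class M \<gamma>) = \<gamma> 1"
proof -
  have "(SOME \<delta>. \<delta> \<in> path_class M \<gamma>) \<in> path_class M \<gamma>"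
    using path_class_self[OF assms] by (rule someI[where P = "\<lambda>\<delta>. \<delta> \<in> path_class M \<gamma>"])
  then show ?thesis unfolding endpoint_proj_def path_class_def using lip_homotopic_ends(2) by fastforce
qed

lemma endpoint_proj_mspace: "A \<in> path_space M p0 \<Longrightarrow> endpoint_proj A \<in> mspace M"
  by (metis path_spaceE endpoint_proj_path_class lip_path_mspace atLeastAtMost_iff order_refl zero_le_one)

lemma connects_lip_path:
  assumes "A \<in> path_space M p0" "B \<in> path_space M p0" "connects M A B \<beta>"
  shows "lip_path M \<beta>" "\<beta> 0 = endpoint_proj A" "\<beta> 1 = endpoint_proj B"
proof -
  obtain \<gamma> \<delta> where *: "lip_path M \<gamma>" "\<gamma> 0 = p0" "A = path_class M \<gamma>" "lip_path M \<delta>" "\<delta> 0 = p0" "B = path_class M \<delta>"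
    using assms path_spaceE by metis
  then have "lip_path M \<beta> \<and> \<gamma> 1 = \<beta> 0 \<and> lip_homotopic M (concat_path \<gamma> \<beta>) \<delta>"
    using connects_iff[of M \<gamma> \<delta>] assms(3) by simp
  then show "lip_path M \<beta>" "\<beta> 0 = endpoint_proj A" "\<beta> 1 = endpoint_proj B"
    using * lip_homotopic_ends(2)[of M "concat_path \<gamma> \<beta>" \<delta>] by (auto simp: endpoint_proj_path_class)
qed

lemma connects_homotopic:
  assumes "connects M A B \<beta>" "lip_homotopic M \<beta>' \<beta>"
  shows "connects M A B \<beta>'"
  using assms lip_homotopic_trans unfolding connects_def by blast

lemma connects_exists:
  assumes "A \<in> path_space M p0" "B \<in> path_space M p0"
  obtains \<beta> where "connects M A B \<beta>"
proof -
  obtain \<gamma> \<delta> where *: "lip_path M \<gamma>" "\<gamma> 0 = p0" "A = path_class M \<gamma>" "lip_path M \<delta>" "\<delta> 0 = p0" "B = path_class M \<delta>"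
    using assms path_spaceE by metis
  then have "lip_path M (concat_path (inverse_path \<gamma>) \<delta>)"
    by (simp add: lip_path_concat_path lip_path_inverse_path)
  then show thesis
    using that[of "concat_path (inverse_path \<gamma>) \<delta>"] * path_class_self lip_homotopic_refl
    unfolding connects_def by metis
qed

lemma connects_extend:
  assumes "A \<in> path_space M p0" "lip_path M \<beta>" "\<beta> 0 = endpoint_proj A"
  obtains B where "B \<in> path_space M p0" "connects M A B \<beta>"
proof -
  obtain \<gamma> where *: "lip_path M \<gamma>" "\<gamma> 0 = p0" "A = path_class M \<gamma>"
    using assms path_spaceE by metis
  then have e: "\<gamma> 1 = \<beta> 0" using assms by (simp add: endpoint_proj_path_class)
  with * assms have l: "lip_path M (concat_path \<gamma> \<beta>)" by (simp add: lip_path_concat_path)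
  show thesis
  proof
    show "path_class M (concat_path \<gamma> \<beta>) \<in> path_space M p0" using l * by (simp add: path_class_in_path_space)
    show "connects M A (path_class M (concat_path \<gamma> \<beta>)) \<beta>"
      using * l e assms connects_iff[of M \<gamma> "concat_path \<gamma> \<beta>" \<beta>] lip_homotopic_refl by simp
  qed
qed

lemma connects_const:
  assumes A: "A \<in> path_space M p0" and p: "p = endpoint_proj A"
  shows "connects M A A (\<lambda>_. p)"
proof -
  obtain \<gamma> where *: "lip_path M \<gamma>" "\<gamma> 0 = p0" "A = path_class M \<gamma>"
    using A path_spaceE by metis
  then show ?thesis
    using connects_iff[of M \<gamma> \<gamma> "\<lambda>_. p"] concat_path_const_right[of M \<gamma> p] endpoint_proj_mspace[OF A]
    by (simp add: endpoint_proj_path_class lip_path_const p)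
qed

lemma connects_concat:
  assumes S: "A \<in> path_space M p0" "B \<in> path_space M p0" "C \<in> path_space M p0"
    and AB: "connects M A B \<beta>" and BC: "connects M B C \<beta>'"
  shows "connects M A C (concat_path \<beta> \<beta>')"
proof -
  obtain a b c where *: "lip_path M a" "a 0 = p0" "A = path_class M a" "lip_path M b" "b 0 = p0" "B = path_class M b"
     "lip_path M c" "c 0 = p0" "C = path_class M c"
    using S path_spaceE by metis
  have 1: "lip_path M \<beta>" "a 1 = \<beta> 0" "lip_homotopic M (concat_path a \<beta>) b"
    using connects_iff[of M a b \<beta>] AB * by auto
  have 2: "lip_path M \<beta>'" "b 1 = \<beta>' 0" "lip_homotopic M (concat_path b \<beta>') c"
    using connects_iff[of M b c \<beta>'] BC * by auto
  have e: "\<beta> 1 = \<beta>' 0" using lip_homotopic_ends(2)[OF 1(3)] 2(2) by simp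
  have "lip_homotopic M (concat_path a (concat_path \<beta> \<beta>')) (concat_path (concat_path a \<beta>) \<beta>')"
    using * 1 2 e by (intro concat_path_assoc)
  also have "lip_homotopic M \<dots> (concat_path b \<beta>')"
    using 1 2 e by (intro lip_homotopic_concat_path lip_homotopic_refl) auto
  also have "lip_homotopic M \<dots> c" by (rule 2)
  finally show ?thesis
    using connects_iff[of M a c "concat_path \<beta> \<beta>'"] * 1 2 e by (simp add: lip_path_concat_path)
qed

lemma connects_inverse:
  assumes S: "A \<in> path_space M p0" "B \<in> path_space M p0" and AB: "connects M A B \<beta>"
  shows "connects M B A (inverse_path \<beta>)"
proof -
  obtain a b where *: "lip_path M a" "a 0 = p0" "A = path_class M a" "lip_path M b" "b 0 = p0" "B = path_class M b"
    using S path_spaceE by metis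
  have 1: "lip_path M \<beta>" "a 1 = \<beta> 0" "lip_homotopic M (concat_path a \<beta>) b"
    using connects_iff[of M a b \<beta>] AB * by auto
  have e: "\<beta> 1 = b 1" using lip_homotopic_ends(2)[OF 1(3)] by simp
  have i: "lip_path M (inverse_path \<beta>)" using 1 by (simp add: lip_path_inverse_path)
  have "lip_homotopic M (concat_path b (inverse_path \<beta>)) (concat_path (concat_path a \<beta>) (inverse_path \<beta>))"
    using 1 i e by (intro lip_homotopic_concat_path lip_homotopic_sym[OF 1(3)] lip_homotopic_refl) auto
  also have "lip_homotopic M \<dots> (concat_path a (concat_path \<beta> (inverse_path \<beta>)))"
    using * 1 i by (intro lip_homotopic_sym[OF concat_path_assoc]) auto
  also have "lip_homotopic M \<dots> (concat_path a (\<lambda>_. \<beta> 0))"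
    using * 1 by (intro lip_homotopic_concat_path lip_homotopic_refl concat_path_inverse_right) auto
  also have "lip_homotopic M \<dots> a" using * 1 by (intro concat_path_const_right) auto
  finally show ?thesis using connects_iff[of M b a "inverse_path \<beta>"] * i e by simp
qed

lemma connects_target_unique:
  assumes S: "A \<in> path_space M p0" "B \<in> path_space M p0" "C \<in> path_space M p0"
    and "connects M A B \<beta>" "connects M A C \<beta>"
  shows "B = C"
proof -
  obtain a b c where *: "lip_path M a" "a 0 = p0" "A = path_class M a" "lip_path M b" "b 0 = p0" "B = path_class M b"
     "lip_path M c" "c 0 = p0" "C = path_class M c"
    using S path_spaceE by metis
  then have "lip_homotopic M (concat_path a \<beta>) b" "lip_homotopic M (concat_path a \<beta>) c"
    using assms connects_iff[of M a b \<beta>] connects_iff[of M a c \<beta>] by auto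
  then have "lip_homotopic M b c" using lip_homotopic_sym lip_homotopic_trans by blast
  then show ?thesis using * by (simp add: path_class_eq_iff)
qed

lemma connects_path_unique:
  assumes S: "A \<in> path_space M p0" "B \<in> path_space M p0"
    and "connects M A B \<beta>" "connects M A B \<beta>'"
  shows "lip_homotopic M \<beta> \<beta>'"
proof -
  obtain a b where *: "lip_path M a" "a 0 = p0" "A = path_class M a" "lip_path M b" "b 0 = p0" "B = path_class M b"
    using S path_spaceE by metis
  have c: "lip_homotopic M \<eta> (concat_path (inverse_path a) b)" if "connects M A B \<eta>" for \<eta>
  proof -
    have \<eta>: "lip_path M \<eta>" "a 1 = \<eta> 0" "lip_homotopic M (concat_path a \<eta>) b"
      using connects_iff[of M a b \<eta>] that * by auto
    have "lip_homotopic M \<eta> (concat_path (inverse_path a) (concat_path a \<eta>))"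
      using * \<eta> by (intro lip_homotopic_sym[OF concat_path_cancel_left]) auto
    also have "lip_homotopic M \<dots> (concat_path (inverse_path a) b)"
      using * \<eta> by (intro lip_homotopic_concat_path lip_homotopic_refl lip_path_inverse_path) auto
    finally show ?thesis .
  qed
  show ?thesis using c[OF assms(3)] c[OF assms(4)] lip_homotopic_sym lip_homotopic_trans by blast
qed

text \<open>
  Used to recognize lifts of constant paths as constant.
\<close>

lemma connects_constant_path_eq:
  assumes S: "A \<in> path_space M p0" "B \<in> path_space M p0"
    and AB: "connects M A B \<beta>" and const: "\<And>t. t \<in> {0..1} \<Longrightarrow> \<beta> t = \<beta> 0"
  shows "A = B"
proof (rule connects_target_unique[OF S(1,1,2) _ AB])
  have "lip_homotopic M \<beta> (\<lambda>_. \<beta> 0)"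
    using connects_lip_path(1)[OF S AB] const by (rule lip_homotopic_cong)
  then show "connects M A A \<beta>"
    by (rule connects_homotopic[OF connects_const[OF S(1) connects_lip_path(2)[OF S AB]]])
qed

lemma path_space_dist_eq:
  assumes "A \<in> path_space M p0" "B \<in> path_space M p0"
  shows "path_space_dist M p0 A B = Inf {length_of M \<beta> | \<beta>. connects M A B \<beta>}"
  using assms by (simp add: path_space_dist_def connects_def)

lemma path_space_dist_le:
  assumes "A \<in> path_space M p0" "B \<in> path_space M p0" "connects M A B \<beta>"
  shows "path_space_dist M p0 A B \<le> length_of M \<beta>"
  unfolding path_space_dist_eq[OF assms(1,2)]
proof (rule cInf_lower)
  show "bdd_below {length_of M \<beta> | \<beta>. connects M A B \<beta>}"
    using length_of_nonneg connects_lip_path(1)[OF assms(1,2)] by (intro bdd_belowI[of _ 0]) auto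
qed (use assms in blast)

lemma path_space_dist_ge:
  assumes "A \<in> path_space M p0" "B \<in> path_space M p0" "\<And>\<beta>. connects M A B \<beta> \<Longrightarrow> r \<le> length_of M \<beta>"
  shows "r \<le> path_space_dist M p0 A B"
  unfolding path_space_dist_eq[OF assms(1,2)]
  by (rule cInf_greatest) (use assms(3) connects_exists[OF assms(1,2)] in blast)+

lemma path_space_dist_lessD:
  assumes "A \<in> path_space M p0" "B \<in> path_space M p0" "path_space_dist M p0 A B < r"
  obtains \<beta> where "connects M A B \<beta>" "length_of M \<beta> < r"
  using path_space_dist_ge[OF assms(1,2), of r] assms(3) by (meson not_less)

lemma mdist_endpoint_proj_le:
  assumes "A \<in> path_space M p0" "B \<in> path_space M p0"
  shows "mdist M (endpoint_proj A) (endpoint_proj B) \<le> path_space_dist M p0 A B"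
proof (rule path_space_dist_ge[OF assms])
  fix \<beta> assume "connects M A B \<beta>"
  note c = connects_lip_path[OF assms this]
  show "mdist M (endpoint_proj A) (endpoint_proj B) \<le> length_of M \<beta>"
    using c(1) mdist_le_length_on[of 0 1 M _ \<beta>] unfolding c(2,3)[symmetric] by (auto simp: lip_path_iff)
qed

lemma path_space_dist_commute_le:
  assumes "A \<in> path_space M p0" "B \<in> path_space M p0"
  shows "path_space_dist M p0 A B \<le> path_space_dist M p0 B A"
proof (rule path_space_dist_ge[OF assms(2,1)])
  fix \<beta> assume \<beta>: "connects M B A \<beta>"
  have "path_space_dist M p0 A B \<le> length_of M (inverse_path \<beta>)"
    using assms connects_inverse[OF assms(2,1) \<beta>] by (rule path_space_dist_le)
  also have "\<dots> \<le> length_of M \<beta>"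
    using connects_lip_path(1)[OF assms(2,1) \<beta>] by (rule length_of_inverse_path_le)
  finally show "path_space_dist M p0 A B \<le> length_of M \<beta>" .
qed

lemma path_space_dist_triangle:
  assumes S: "A \<in> path_space M p0" "B \<in> path_space M p0" "C \<in> path_space M p0"
  shows "path_space_dist M p0 A C \<le> path_space_dist M p0 A B + path_space_dist M p0 B C"
proof -
  have le: "path_space_dist M p0 A C \<le> length_of M \<beta> + length_of M \<beta>'"
    if b: "connects M A B \<beta>" "connects M B C \<beta>'" for \<beta> \<beta>'
  proof -
    have "path_space_dist M p0 A C \<le> length_of M (concat_path \<beta> \<beta>')"
      using S(1,3) connects_concat[OF S b] by (rule path_space_dist_le)
    also have "\<dots> \<le> length_of M \<beta> + length_of M \<beta>'"
      using connects_lip_path[OF S(1,2) b(1)] connects_lip_path[OF S(2,3) b(2)]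
      by (intro length_of_concat_path_le) auto
    finally show ?thesis .
  qed
  have "path_space_dist M p0 A C - length_of M \<beta>' \<le> path_space_dist M p0 A B" if "connects M B C \<beta>'" for \<beta>'
    using le[OF _ that] by (intro path_space_dist_ge[OF S(1,2)]) (simp add: diff_le_eq)
  then have "path_space_dist M p0 A C - path_space_dist M p0 A B \<le> path_space_dist M p0 B C"
    by (intro path_space_dist_ge[OF S(2,3)]) (simp add: algebra_simps)
  then show ?thesis by simp
qed

text \<open>
  Distinct classes have positive distance because the infimum defining the distance is attained:
  a minimizer of length zero is constant.
\<close>

lemma path_space_dist_zero_imp_eq:
  assumes M: "tree_like_homotopy_space M" and S: "A \<in> path_space M p0" "B \<in> path_space M p0"
    and zero: "path_space_dist M p0 A B = 0"
  shows "A = B"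
proof -
  obtain \<beta> where \<beta>: "connects M A B \<beta>" using connects_exists[OF S] .
  obtain \<delta> where \<delta>: "lip_homotopic M \<beta> \<delta>" "arc_length_parametrized M 0 1 \<delta>"
      "length_minimizing_in M (path_class M \<beta>) \<delta>"
    using arc_length_minimizer_exists[OF M connects_lip_path(1)[OF S \<beta>]] .
  have c: "connects M A B \<delta>" using \<beta> lip_homotopic_sym[OF \<delta>(1)] by (rule connects_homotopic)
  note \<delta>l = connects_lip_path(1)[OF S c]
  have "length_of M \<delta> \<le> path_space_dist M p0 A B"
  proof (rule path_space_dist_ge[OF S])
    fix \<eta> assume "connects M A B \<eta>"
    with S \<beta> have "\<eta> \<in> path_class M \<beta>" by (simp add: path_class_def connects_path_unique)
    then show "length_of M \<delta> \<le> length_of M \<eta>" using \<delta>(3) by (simp add: length_minimizing_in_def)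
  qed
  then have "length_of M \<delta> = 0" using zero length_of_nonneg[OF \<delta>l] by simp
  then have L: "lip_on M 0 {0..1} \<delta>" using arc_length_parametrized_lip_on[OF \<delta>l \<delta>(2)] by simp
  show "A = B"
  proof (rule connects_constant_path_eq[OF S c])
    fix t :: real assume t: "t \<in> {0..1}"
    have "mdist M (\<delta> t) (\<delta> 0) \<le> 0" using lip_onD[OF L t, of 0] by simp
    then have "mdist M (\<delta> t) (\<delta> 0) = 0" by (simp add: order_antisym)
    then show "\<delta> t = \<delta> 0" using lip_on_mspace[OF L] t by simp
  qed
qed

theorem Metric_space_path_space:
  assumes M: "tree_like_homotopy_space M"
  shows "Metric_space (path_space M p0) (path_space_dist M p0)"
proof
  fix A B C
  show "0 \<le> path_space_dist M p0 A B"
  proof (cases "A \<in> path_space M p0 \<and> B \<in> path_space M p0")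
    case True
    then show ?thesis
      by (meson path_space_dist_ge length_of_nonneg connects_lip_path(1))
  qed (auto simp: path_space_dist_def)
  show "path_space_dist M p0 A B = path_space_dist M p0 B A"
  proof (cases "A \<in> path_space M p0 \<and> B \<in> path_space M p0")
    case True
    then show ?thesis using path_space_dist_commute_le by (intro order_antisym) auto
  qed (auto simp: path_space_dist_def)
  assume S: "A \<in> path_space M p0" "B \<in> path_space M p0"
  have "path_space_dist M p0 A A \<le> 0"
  proof -
    have "path_space_dist M p0 A A \<le> length_of M (\<lambda>_. endpoint_proj A)"
      using S by (intro path_space_dist_le connects_const) auto
    also have "\<dots> \<le> 0 * (1 - 0)"
      using endpoint_proj_mspace[OF S(1)] by (intro length_on_le_lip lip_on_const) auto
    finally show ?thesis by simp
  qed
  moreover have "0 \<le> path_space_dist M p0 A A"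
    by (meson S path_space_dist_ge length_of_nonneg connects_lip_path(1))
  ultimately show "path_space_dist M p0 A B = 0 \<longleftrightarrow> A = B"
    using path_space_dist_zero_imp_eq[OF M S] by auto
  assume "C \<in> path_space M p0"
  with S show "path_space_dist M p0 A C \<le> path_space_dist M p0 A B + path_space_dist M p0 B C"
    by (rule path_space_dist_triangle)
qed

lemma path_space_metric_simps:
  assumes "tree_like_homotopy_space M"
  shows "mspace (path_space_metric M p0) = path_space M p0"
    "mdist (path_space_metric M p0) = path_space_dist M p0"
  unfolding path_space_metric_def
  using Metric_space.mspace_metric[OF Metric_space_path_space[OF assms]]
    Metric_space.mdist_metric[OF Metric_space_path_space[OF assms]] by auto

section \<open>Lifting maps from convex domains\<close>

definition segment_path :: "'b::real_normed_vector \<Rightarrow> 'b \<Rightarrow> real \<Rightarrow> 'b" where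
  "segment_path x y = (\<lambda>t. (1 - t) *\<^sub>R x + t *\<^sub>R y)"

lemma segment_path_ends [simp]: "segment_path x y 0 = x" "segment_path x y 1 = y"
  by (auto simp: segment_path_def)

lemma segment_path_const [simp]: "segment_path x x t = x"
  by (simp add: segment_path_def flip: scaleR_left_distrib)

lemma segment_path_lipschitz: "(dist x y)-lipschitz_on S (segment_path x y)"
proof (rule lipschitz_onI)
  fix s t :: real
  have "segment_path x y s - segment_path x y t = (s - t) *\<^sub>R (y - x)"
    by (simp add: segment_path_def algebra_simps)
  then show "dist (segment_path x y s) (segment_path x y t) \<le> dist x y * dist s t"
    by (simp add: dist_norm norm_minus_commute mult.commute)
qed simp

lemma segment_path_in:
  assumes "convex D" "x \<in> D" "y \<in> D" "t \<in> {0..1}"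
  shows "segment_path x y t \<in> D"
  using assms by (auto simp: segment_path_def intro: convexD)

lemma lip_on_segment_path:
  assumes "lip_on M L D F" "convex D" "x \<in> D" "y \<in> D"
  shows "lip_on M (L * dist x y) {0..1} (\<lambda>t. F (segment_path x y t))"
  by (rule lip_on_compose[OF assms(1) segment_path_lipschitz]) (use assms segment_path_in in blast)

lemma concat_segment_paths:
  fixes F :: "'b::real_normed_vector \<Rightarrow> 'a"
  assumes F: "lip_on M L D F" and D: "convex D" and xyz: "x \<in> D" "y \<in> D" "z \<in> D"
  shows "lip_homotopic M
    (concat_path (\<lambda>t. F (segment_path x y t)) (\<lambda>t. F (segment_path y z t)))
    (\<lambda>t. F (segment_path x z t))"
proof -
  let ?c = "concat_path (segment_path x y) (segment_path y z)"
  define K where "K = max (dist x y) (dist y z)"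
  have e: "lip_on euclidean_metric K {0..1} (f :: real \<Rightarrow> 'b) \<longleftrightarrow> K-lipschitz_on {0..1} f" for K f
    by (auto simp: lip_on_def lipschitz_on_def)
  have "K-lipschitz_on {0..1} (segment_path x y)" "K-lipschitz_on {0..1} (segment_path y z)"
    by (rule lipschitz_on_le[OF segment_path_lipschitz], simp add: K_def)+
  then have "(2 * K)-lipschitz_on {0..1} ?c"
    using lip_on_concat_path[of euclidean_metric K "segment_path x y" "segment_path y z"]
    by (simp add: e)
  moreover have "?c ` {0..1} \<subseteq> D"
    using segment_path_in[OF D] xyz by (auto simp: concat_path_def)
  ultimately have "lip_homotopic M (\<lambda>t. F (?c t)) (\<lambda>t. F (segment_path x z t))"
    by (rule lip_homotopic_straight[OF F D])
      (use segment_path_lipschitz segment_path_in[OF D] xyz in auto)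
  then show ?thesis by (simp add: concat_path_def if_distrib cong: if_cong)
qed

text \<open>
  The value \<open>G z\<close> continues \<open>A\<close> along the image of the segment from \<open>z0\<close> to \<open>z\<close>. By convexity the
  segments from \<open>z0\<close> to \<open>x\<close> and from \<open>x\<close> to \<open>y\<close> together are homotopic to the segment from \<open>z0\<close> to
  \<open>y\<close>. Therefore the image of the segment from \<open>x\<close> to \<open>y\<close> connects \<open>G x\<close> to \<open>G y\<close>, and its length
  bounds their distance.
\<close>

lemma convex_domain_lift:
  fixes F :: "'b::real_normed_vector \<Rightarrow> 'a"
  assumes M: "tree_like_homotopy_space M"
    and F: "lip_on M L D F" and D: "convex D" and z0: "z0 \<in> D"
    and A: "A \<in> path_space M p0" "endpoint_proj A = F z0"
  obtains G where "lip_on (path_space_metric M p0) L D G" "G z0 = A"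
    "\<And>x y. x \<in> D \<Longrightarrow> y \<in> D \<Longrightarrow> connects M (G x) (G y) (\<lambda>t. F (segment_path x y t))"
proof -
  have lp: "lip_path M (\<lambda>t. F (segment_path x y t))" if "x \<in> D" "y \<in> D" for x y
    using lip_on_segment_path[OF F D that] lip_path_iff by blast
  have "\<exists>B. B \<in> path_space M p0 \<and> connects M A B (\<lambda>t. F (segment_path z0 x t))" if "x \<in> D" for x
    using connects_extend[OF A(1) lp[OF z0 that]] A(2) by auto
  then obtain G where G: "\<And>x. x \<in> D \<Longrightarrow> G x \<in> path_space M p0"
      "\<And>x. x \<in> D \<Longrightarrow> connects M A (G x) (\<lambda>t. F (segment_path z0 x t))" by metis
  have c: "connects M (G x) (G y) (\<lambda>t. F (segment_path x y t))" if xy: "x \<in> D" "y \<in> D" for x y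
  proof -
    let ?a = "\<lambda>t. F (segment_path z0 x t)" and ?b = "\<lambda>t. F (segment_path x y t)"
    have "endpoint_proj (G x) = F x" using connects_lip_path(3)[OF A(1) G(1) G(2)] xy by simp
    then obtain B where B: "B \<in> path_space M p0" "connects M (G x) B ?b"
      using connects_extend[OF G(1)[OF xy(1)] lp[OF xy]] by auto
    have "connects M A B (concat_path ?a ?b)"
      using A(1) G(1)[OF xy(1)] B(1) G(2)[OF xy(1)] B(2) by (rule connects_concat)
    then have "connects M A B (\<lambda>t. F (segment_path z0 y t))"
      using lip_homotopic_sym[OF concat_segment_paths[OF F D z0 xy]] by (rule connects_homotopic)
    then have "B = G y" using connects_target_unique[OF A(1) B(1) G(1)] G(2) xy by blast
    with B show ?thesis by simp
  qed
  note P = path_space_metric_simps[OF M, of p0]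
  show thesis
  proof
    show "G z0 = A"
      using connects_constant_path_eq[OF A(1) G(1)[OF z0] G(2)[OF z0]] by simp
    show "lip_on (path_space_metric M p0) L D G"
    proof (rule lip_onI)
      fix x y assume xy: "x \<in> D" "y \<in> D"
      show "G x \<in> mspace (path_space_metric M p0)" using G xy by (simp add: P)
      have "path_space_dist M p0 (G x) (G y) \<le> length_of M (\<lambda>t. F (segment_path x y t))"
        using G(1) c xy by (intro path_space_dist_le)
      also have "\<dots> \<le> L * dist x y * (1 - 0)"
        using lip_on_segment_path[OF F D xy] by (intro length_on_le_lip) auto
      finally show "mdist (path_space_metric M p0) (G x) (G y) \<le> L * dist x y" by (simp add: P)
    qed (rule lip_on_nonneg[OF F])
  qed (rule c)
qed

section \<open>The path space is a length space\<close>

lemma sum_length_on_partition: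
  assumes \<gamma>: "lip_on M L {a..b} \<gamma>" and t: "is_partition a b n t"
  shows "(\<Sum>i<n. length_on M (t i) (t (Suc i)) \<gamma>) = length_on M a b \<gamma>"
proof -
  have "(\<Sum>i<k. length_on M (t i) (t (Suc i)) \<gamma>) = length_on M a (t k) \<gamma>" if "k \<le> n" for k
    using that
  proof (induction k)
    case 0
    have a: "t 0 = a" using t by (simp add: is_partition_def)
    have L: "lip_on M L {a..a} \<gamma>"
      using is_partition_range[OF t, of 0] a by (intro lip_on_mono[OF \<gamma>]) auto
    show ?case using length_on_le_lip[OF _ L] length_on_nonneg[OF _ L] a by simp
  next
    case (Suc k)
    have "length_on M a (t (Suc k)) \<gamma> = length_on M a (t k) \<gamma> + length_on M (t k) (t (Suc k)) \<gamma>"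
      using is_partition_range[OF t, of k] is_partition_range[OF t, of "Suc k"] Suc.prems
        is_partition_mono[OF t, of k "Suc k"]
      by (intro length_on_split[OF _ _ lip_on_mono[OF \<gamma> _ order_refl]]) auto
    then show ?case using Suc by simp
  qed
  from this[of n] show ?thesis using t by (simp add: is_partition_def)
qed

text \<open>
  On the path of continuations of \<open>A\<close> along the initial pieces of \<open>\<beta>\<close>, the distance of two points is
  at most the length of the piece of \<open>\<beta>\<close> between them, and the lengths of pieces add up.
\<close>

lemma connects_imp_path_in_path_space:
  assumes M: "tree_like_homotopy_space M"
    and A: "A \<in> path_space M p0" and B: "B \<in> path_space M p0" and \<beta>: "connects M A B \<beta>"
  obtains G where "lip_path (path_space_metric M p0) G" "G 0 = A" "G 1 = B"
    "length_of (path_space_metric M p0) G \<le> length_of M \<beta>"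
proof -
  obtain L where L: "lip_on M L {0..1} \<beta>" using connects_lip_path(1)[OF A B \<beta>] lip_path_iff by blast
  obtain G where G: "lip_on (path_space_metric M p0) L {0..1} G" "G 0 = A"
    "\<And>x y. x \<in> {0..1} \<Longrightarrow> y \<in> {0..1} \<Longrightarrow> connects M (G x) (G y) (\<lambda>t. \<beta> (segment_path x y t))"
    using convex_domain_lift[OF M L _ _ A, of 0] connects_lip_path(2)[OF A B \<beta>] by auto
  note P = path_space_metric_simps[OF M, of p0]
  have GP: "G x \<in> path_space M p0" if "x \<in> {0..1}" for x using lip_on_mspace[OF G(1) that] P by simp
  have "connects M A (G 1) \<beta>" using G(3)[of 0 1] G(2) by (simp add: segment_path_def)
  then have G1: "G 1 = B" using connects_target_unique[OF A GP B _ \<beta>] by simp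
  have "length_of (path_space_metric M p0) G \<le> length_of M \<beta>"
  proof (rule length_on_le)
    fix n t assume t: "is_partition 0 1 n t"
    have "partition_sum (path_space_metric M p0) G n t \<le> (\<Sum>i<n. length_on M (t i) (t (Suc i)) \<beta>)"
      unfolding partition_sum_def P
    proof (rule sum_mono)
      fix i assume "i \<in> {..<n}"
      then have i: "t i \<in> {0..1}" "t (Suc i) \<in> {0..1}" "t i \<le> t (Suc i)"
        using is_partition_range[OF t] is_partition_mono[OF t, of i "Suc i"] by auto
      let ?s = "segment_path (t i) (t (Suc i))"
      have "path_space_dist M p0 (G (t i)) (G (t (Suc i))) \<le> length_of M (\<lambda>u. \<beta> (?s u))"
        using i GP G(3) by (intro path_space_dist_le)
      also have "\<dots> \<le> length_on M (?s 0) (?s 1) \<beta>"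
      proof (rule length_on_reparam_le)
        show "lip_on M L {?s 0..?s 1} \<beta>" using i by (intro lip_on_mono[OF L]) auto
        fix u v :: real assume "u \<le> v"
        then have "u * (t (Suc i) - t i) \<le> v * (t (Suc i) - t i)" using i by (intro mult_right_mono) auto
        then show "?s u \<le> ?s v" by (simp add: segment_path_def algebra_simps)
      qed simp
      finally show "path_space_dist M p0 (G (t i)) (G (t (Suc i))) \<le> length_on M (t i) (t (Suc i)) \<beta>" by simp
    qed
    also have "\<dots> = length_of M \<beta>" by (rule sum_length_on_partition[OF L t])
    finally show "partition_sum (path_space_metric M p0) G n t \<le> length_of M \<beta>" .
  qed simp
  then show thesis using that G(1,2) G1 lip_path_iff by blast
qed

theorem length_space_path_space:
  assumes M: "tree_like_homotopy_space M"
  shows "length_space (path_space_metric M p0)"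
  unfolding length_space_def quasi_convex_with_def
proof (intro allI impI ballI)
  note P = path_space_metric_simps[OF M, of p0]
  fix C :: real and A B
  assume C: "1 < C" and "A \<in> mspace (path_space_metric M p0)" "B \<in> mspace (path_space_metric M p0)"
  then have A: "A \<in> path_space M p0" and B: "B \<in> path_space M p0" by (simp_all add: P)
  have "\<exists>\<beta>. connects M A B \<beta> \<and> length_of M \<beta> \<le> C * path_space_dist M p0 A B"
  proof (cases "A = B")
    case True
    have "length_of M (\<lambda>_. endpoint_proj A) \<le> 0 * (1 - 0)"
      using endpoint_proj_mspace[OF A] by (intro length_on_le_lip lip_on_const) auto
    moreover have "0 \<le> C * path_space_dist M p0 A B"
      using C Metric_space.nonneg[OF Metric_space_path_space[OF M]] by (intro mult_nonneg_nonneg) auto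
    ultimately show ?thesis using connects_const[OF A refl] True by force
  next
    case False
    then have "0 < path_space_dist M p0 A B"
      using Metric_space.mdist_pos_less[OF Metric_space_path_space[OF M]] A B by blast
    then have "path_space_dist M p0 A B < C * path_space_dist M p0 A B" using C by simp
    then show ?thesis using path_space_dist_lessD[OF A B] less_imp_le by metis
  qed
  then obtain \<beta> where \<beta>: "connects M A B \<beta>" "length_of M \<beta> \<le> C * path_space_dist M p0 A B" by blast
  obtain G where "lip_path (path_space_metric M p0) G" "G 0 = A" "G 1 = B"
      "length_of (path_space_metric M p0) G \<le> length_of M \<beta>"
    using connects_imp_path_in_path_space[OF M A B \<beta>(1)] .
  then show "\<exists>\<gamma>. lip_path (path_space_metric M p0) \<gamma> \<and> \<gamma> 0 = A \<and> \<gamma> 1 = B \<and>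
      length_of (path_space_metric M p0) \<gamma> \<le> C * mdist (path_space_metric M p0) A B"
    using \<beta>(2) unfolding P(2) by (intro exI[of _ G]) auto
qed

section \<open>Unique path lifting\<close>

text \<open>
  A Lipschitz path \<open>c\<close> in the path space can be approximated by paths in \<open>M\<close>: connect the values of
  \<open>c\<close> at consecutive dyadic points by paths of almost minimal length. The strict inequality
  \<open>L < K\<close> leaves room for the infimum in the distance and is inherited by both halves of \<open>c\<close>.
\<close>

lemma dyadic_approximation:
  assumes M: "tree_like_homotopy_space M"
    and c: "lip_on (path_space_metric M p0) L {0..1} c" and LK: "L < K"
  shows "\<exists>\<beta>. connects M (c 0) (c 1) \<beta> \<and> lip_on M K {0..1} \<beta> \<and>
    (\<forall>s\<in>{0..1}. mdist M (\<beta> s) (endpoint_proj (c s)) \<le> 2 * K / 2 ^ n)"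
  using c LK
proof (induction n arbitrary: c L K)
  case 0
  note P = path_space_metric_simps[OF M, of p0]
  have cP: "c s \<in> path_space M p0" if "s \<in> {0..1}" for s using lip_on_mspace[OF 0(1) that] P by simp
  have S: "c 0 \<in> path_space M p0" "c 1 \<in> path_space M p0" using cP by auto
  have L0: "0 \<le> L" using lip_on_nonneg[OF 0(1)] .
  have "path_space_dist M p0 (c 0) (c 1) \<le> L" using lip_onD[OF 0(1), of 0 1] by (simp add: P)
  then obtain \<beta> where \<beta>: "connects M (c 0) (c 1) \<beta>" "length_of M \<beta> < K"
    using path_space_dist_lessD[OF S, of K] 0(2) by auto
  obtain \<delta> where \<delta>: "lip_homotopic M \<beta> \<delta>" "lip_on M (length_of M \<beta>) {0..1} \<delta>"
    using arc_length_reparametrization[OF connects_lip_path(1)[OF S \<beta>(1)]] by metis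
  have con: "connects M (c 0) (c 1) \<delta>" using \<beta>(1) lip_homotopic_sym[OF \<delta>(1)] by (rule connects_homotopic)
  have \<delta>K: "lip_on M K {0..1} \<delta>" using \<delta>(2) \<beta>(2) by (auto intro: lip_on_mono)
  have "mdist M (\<delta> s) (endpoint_proj (c s)) \<le> 2 * K" if s: "s \<in> {0..1}" for s
  proof -
    have "mdist M (\<delta> s) (endpoint_proj (c s)) \<le> mdist M (\<delta> s) (\<delta> 0) + mdist M (\<delta> 0) (endpoint_proj (c s))"
      using s lip_on_mspace[OF \<delta>K] endpoint_proj_mspace[OF cP] by (intro mdist_triangle) auto
    also have "mdist M (\<delta> 0) (endpoint_proj (c s)) \<le> path_space_dist M p0 (c 0) (c s)"
      unfolding connects_lip_path(2)[OF S con] using mdist_endpoint_proj_le[OF S(1) cP[OF s]] .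
    also have "\<dots> \<le> L * dist 0 s" using lip_onD[OF 0(1), of 0 s] s by (simp add: P)
    also have "L * dist 0 s \<le> L * 1" using s L0 by (intro mult_left_mono) auto
    also have "mdist M (\<delta> s) (\<delta> 0) \<le> K * dist s 0" using s by (intro lip_onD[OF \<delta>K]) auto
    also have "K * dist s 0 \<le> K * 1" using s L0 0(2) by (intro mult_left_mono) auto
    finally show ?thesis using 0(2) by simp
  qed
  then show ?case using con \<delta>K by auto
next
  case (Suc n)
  note P = path_space_metric_simps[OF M, of p0]
  define c1 c2 where "c1 = (\<lambda>s. c (s / 2))" and "c2 = (\<lambda>s. c (s / 2 + 1/2))"
  have "lip_on (path_space_metric M p0) (L * (1/2)) {0..1} c1"
    unfolding c1_def by (rule lip_on_compose[OF Suc.prems(1)]) (auto simp: lipschitz_on_def dist_real_def abs_if)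
  moreover have "L * (1/2) < K / 2" using Suc.prems(2) by simp
  ultimately have "\<exists>\<beta>. connects M (c1 0) (c1 1) \<beta> \<and> lip_on M (K/2) {0..1} \<beta> \<and>
    (\<forall>s\<in>{0..1}. mdist M (\<beta> s) (endpoint_proj (c1 s)) \<le> 2 * (K/2) / 2 ^ n)" by (rule Suc.IH)
  then obtain b1 where b1: "connects M (c 0) (c (1/2)) b1" "lip_on M (K/2) {0..1} b1"
    "\<And>s. s \<in> {0..1} \<Longrightarrow> mdist M (b1 s) (endpoint_proj (c (s / 2))) \<le> 2 * (K/2) / 2 ^ n"
    by (auto simp: c1_def)
  have "lip_on (path_space_metric M p0) (L * (1/2)) {0..1} c2"
    unfolding c2_def by (rule lip_on_compose[OF Suc.prems(1)]) (auto simp: lipschitz_on_def dist_real_def abs_if)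
  moreover have "L * (1/2) < K / 2" using Suc.prems(2) by simp
  ultimately have "\<exists>\<beta>. connects M (c2 0) (c2 1) \<beta> \<and> lip_on M (K/2) {0..1} \<beta> \<and>
    (\<forall>s\<in>{0..1}. mdist M (\<beta> s) (endpoint_proj (c2 s)) \<le> 2 * (K/2) / 2 ^ n)" by (rule Suc.IH)
  then obtain b2 where b2: "connects M (c (1/2)) (c 1) b2" "lip_on M (K/2) {0..1} b2"
    "\<And>s. s \<in> {0..1} \<Longrightarrow> mdist M (b2 s) (endpoint_proj (c (s / 2 + 1/2))) \<le> 2 * (K/2) / 2 ^ n"
    by (auto simp: c2_def)
  have cP: "c s \<in> path_space M p0" if "s \<in> {0..1}" for s
    using lip_on_mspace[OF Suc.prems(1) that] P by simp
  have S: "c 0 \<in> path_space M p0" "c (1/2) \<in> path_space M p0" "c 1 \<in> path_space M p0" using cP by auto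
  have e: "b1 1 = b2 0"
    using connects_lip_path(3)[OF S(1,2) b1(1)] connects_lip_path(2)[OF S(2,3) b2(1)] by simp
  show ?case
  proof (intro exI conjI ballI)
    show "connects M (c 0) (c 1) (concat_path b1 b2)" using S b1(1) b2(1) by (rule connects_concat)
    show "lip_on M K {0..1} (concat_path b1 b2)" using lip_on_concat_path[OF b1(2) b2(2) e] by simp
    fix s :: real assume s: "s \<in> {0..1}"
    show "mdist M (concat_path b1 b2 s) (endpoint_proj (c s)) \<le> 2 * K / 2 ^ Suc n"
    proof (cases "s \<le> 1/2")
      case True
      then show ?thesis using b1(3)[of "2 * s"] s by (simp add: concat_path_left)
    next
      case False
      then show ?thesis using b2(3)[of "2 * s - 1"] s
        by (simp add: concat_path_right[of b1 b2, OF e] diff_divide_distrib)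
    qed
  qed
qed

text \<open>
  The dyadic approximations of \<open>c\<close> are homotopic to one another and converge to \<open>\<pi> \<circ> c\<close>. The
  minimizer \<open>\<delta>\<close> of their class is a common target, and the homotopies to it provided by the tree-like
  property have the Lipschitz constant and the image of the approximations; a cluster homotopy
  joins \<open>\<pi> \<circ> c\<close> to \<open>\<delta>\<close>.
\<close>

theorem connects_projected_path:
  assumes M: "tree_like_homotopy_space M" and c: "lip_path (path_space_metric M p0) c"
  shows "connects M (c 0) (c 1) (\<lambda>s. endpoint_proj (c s))"
proof -
  note P = path_space_metric_simps[OF M, of p0]
  let ?\<gamma> = "\<lambda>s. endpoint_proj (c s)"
  obtain L where L: "lip_on (path_space_metric M p0) L {0..1} c" using c lip_path_iff by blast
  define K where "K = L + 1"
  have cP: "c s \<in> path_space M p0" if "s \<in> {0..1}" for s using lip_on_mspace[OF L that] P by simp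
  have S: "c 0 \<in> path_space M p0" "c 1 \<in> path_space M p0" using cP by auto
  \<comment> \<open>The end point projection does not increase distances, so \<open>?\<gamma>\<close> inherits the constant of \<open>c\<close>.\<close>
  have "lip_on M L {0..1} ?\<gamma>"
  proof (rule lip_onI[OF lip_on_nonneg[OF L]])
    fix s t :: real assume st: "s \<in> {0..1}" "t \<in> {0..1}"
    show "?\<gamma> s \<in> mspace M" using endpoint_proj_mspace[OF cP[OF st(1)]] .
    show "mdist M (?\<gamma> s) (?\<gamma> t) \<le> L * dist s t"
      using mdist_endpoint_proj_le[OF cP[OF st(1)] cP[OF st(2)]] lip_onD[OF L st] by (simp add: P)
  qed
  then have \<gamma>: "lip_path M ?\<gamma>" using lip_path_iff by blast
  have "\<exists>\<beta>. connects M (c 0) (c 1) \<beta> \<and> lip_on M K {0..1} \<beta> \<and>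
    (\<forall>s\<in>{0..1}. mdist M (\<beta> s) (?\<gamma> s) \<le> 2 * K / 2 ^ n)" for n
    by (rule dyadic_approximation[OF M L]) (simp add: K_def)
  then obtain \<beta> where \<beta>: "\<And>n. connects M (c 0) (c 1) (\<beta> n)" "\<And>n. lip_on M K {0..1} (\<beta> n)"
    "\<And>n s. s \<in> {0..1} \<Longrightarrow> mdist M (\<beta> n s) (?\<gamma> s) \<le> 2 * K / 2 ^ n" by metis
  obtain \<delta> where \<delta>: "lip_homotopic M (\<beta> 0) \<delta>" "arc_length_parametrized M 0 1 \<delta>"
      "length_minimizing_in M (path_class M (\<beta> 0)) \<delta>"
    using arc_length_minimizer_exists[OF M connects_lip_path(1)[OF S \<beta>(1)]] .
  have same: "lip_homotopic M (\<beta> n) (\<beta> 0)" for n by (rule connects_path_unique[OF S \<beta>(1) \<beta>(1)])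
  have cls: "path_class M (\<beta> n) = path_class M (\<beta> 0)" for n
    using same connects_lip_path(1)[OF S \<beta>(1)] by (simp add: path_class_eq_iff)
  have "\<exists>h \<beta>'. slice_homotopy M K (\<beta> n) \<beta>' h \<and> (\<forall>s\<in>{0..1}. \<forall>t\<in>{0..1}. h s t \<in> \<beta> n ` {0..1}) \<and>
      (\<forall>t\<in>{0..1}. \<beta>' t = \<delta> t)" for n
  proof (rule tree_like_homotopyE[OF M lip_homotopic_trans[OF same \<delta>(1)] \<beta>(2)[of n]])
    fix h \<beta>' assume "slice_homotopy M K (\<beta> n) \<beta>' h"
      "\<And>s t. s \<in> {0..1} \<Longrightarrow> t \<in> {0..1} \<Longrightarrow> h s t \<in> \<beta> n ` {0..1}"
      "arc_length_parametrized M 0 1 \<delta> \<Longrightarrow> length_minimizing_in M (path_class M (\<beta> n)) \<delta> \<Longrightarrow>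
         \<forall>t\<in>{0..1}. \<beta>' t = \<delta> t"
    then show ?thesis using \<delta>(2,3) cls[of n] by (intro exI[of _ h] exI[of _ \<beta>']) simp
  qed
  then obtain h \<beta>' where h: "\<And>n. slice_homotopy M K (\<beta> n) (\<beta>' n) (h n)"
      "\<And>n s t. s \<in> {0..1} \<Longrightarrow> t \<in> {0..1} \<Longrightarrow> h n s t \<in> \<beta> n ` {0..1}"
      "\<And>n t. t \<in> {0..1} \<Longrightarrow> \<beta>' n t = \<delta> t" by metis
  have "(\<lambda>n. 2 * K * (1/2) ^ n) \<longlonglongrightarrow> 2 * K * 0"
    by (intro tendsto_mult_left LIMSEQ_realpow_zero) auto
  then have null: "(\<lambda>n. 2 * K / 2 ^ n) \<longlonglongrightarrow> 0" by (simp add: power_divide)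
  obtain H b where H: "slice_homotopy M K ?\<gamma> b H" and b: "cluster_map M {0..1} \<beta>' b"
    by (rule slice_homotopy_cluster[OF \<gamma> null h(1,2) \<beta>(3)])
  have \<delta>M: "\<delta> s \<in> mspace M" if "s \<in> {0..1}" for s
    using lip_path_mspace[OF lip_homotopic_lip_path(2)[OF \<delta>(1)] that] .
  have b\<delta>: "b s = \<delta> s" if s: "s \<in> {0..1}" for s
    by (rule cluster_map_eq_limit[OF b _ s \<delta>M[OF s], where e = "\<lambda>_. 0"]) (use h(3) \<delta>M s in auto)
  have "lip_homotopic M ?\<gamma> b" using H by (rule lip_homotopicI)
  also have "lip_homotopic M b \<delta>" using lip_homotopic_lip_path(2)[OF calculation] b\<delta> by (rule lip_homotopic_cong)
  also have "lip_homotopic M \<delta> (\<beta> 0)" using \<delta>(1) by (rule lip_homotopic_sym)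
  finally show ?thesis using connects_homotopic[OF \<beta>(1)] by blast
qed

section \<open>Simple connectivity\<close>

lemma trivial_lip_pi1I:
  assumes x: "x \<in> mspace M"
    and null: "\<And>c. lip_path M c \<Longrightarrow> c 0 = x \<Longrightarrow> c 1 = x \<Longrightarrow> lip_homotopic M c (\<lambda>_. x)"
  shows "trivial_group (lip_pi1 M x)"
proof -
  let ?e = "path_class M (\<lambda>_. x)"
  note k = lip_path_const[OF x]
  have carrier: "carrier (lip_pi1 M x) = {?e}"
  proof (intro equalityI subsetI)
    fix A assume "A \<in> carrier (lip_pi1 M x)"
    then obtain c where c: "A = path_class M c" "lip_path M c" "c 0 = x" "c 1 = x"
      by (auto simp: lip_pi1_def)
    then show "A \<in> {?e}" using null path_class_eq_iff by fastforce
  qed (use k in \<open>auto simp: lip_pi1_def\<close>)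
  have "path_class M (concat_path a b) = ?e" if "a \<in> ?e" "b \<in> ?e" for a b
  proof -
    have ab: "lip_homotopic M (\<lambda>_. x) a" "lip_homotopic M (\<lambda>_. x) b" using that by (auto simp: path_class_def)
    have "lip_path M (concat_path a b)"
      using lip_homotopic_lip_path(2)[OF ab(1)] lip_homotopic_lip_path(2)[OF ab(2)]
        lip_homotopic_ends[OF ab(1)] lip_homotopic_ends[OF ab(2)] by (simp add: lip_path_concat_path)
    moreover from this have "lip_homotopic M (concat_path a b) (\<lambda>_. x)"
      using lip_homotopic_ends[OF ab(1)] lip_homotopic_ends[OF ab(2)] by (intro null) auto
    ultimately show ?thesis by (simp add: path_class_eq_iff)
  qed
  then have "(\<Union>a\<in>?e. \<Union>b\<in>?e. path_class M (concat_path a b)) = ?e"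
    using path_class_self[OF k] by auto
  then have mult: "?e \<otimes>\<^bsub>lip_pi1 M x\<^esub> ?e = ?e" by (simp add: lip_pi1_def)
  have one: "\<one>\<^bsub>lip_pi1 M x\<^esub> = ?e" by (simp add: lip_pi1_def)
  have "group (lip_pi1 M x)" by (rule groupI) (simp_all add: carrier mult one)
  then show ?thesis by (simp add: trivial_group_def carrier one)
qed

lemma dist_pair_sum_le: "dist (fst p) (fst q) + dist (snd p) (snd q) \<le> 2 * dist p (q :: real \<times> real)"
  using dist_fst_le[of p q] dist_snd_le[of p q] by linarith

text \<open>
  A loop \<open>c\<close> in the path space is the lift of its projection, which is null-homotopic because the
  lift closes up. A null-homotopy of the projection lifts to the path space, and by unique path
  lifting the lifted homotopy starts at \<open>c\<close> and is constant on the other three sides.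
\<close>

lemma path_space_loop_null_homotopic:
  assumes M: "tree_like_homotopy_space M"
    and c: "lip_path (path_space_metric M p0) c" "c 0 = A" "c 1 = A"
  shows "lip_homotopic (path_space_metric M p0) c (\<lambda>_. A)"
proof -
  let ?P = "path_space_metric M p0" and ?p = "endpoint_proj A"
  note P = path_space_metric_simps[OF M, of p0]
  define \<gamma> where "\<gamma> = (\<lambda>s. endpoint_proj (c s))"
  have cP: "c s \<in> path_space M p0" if "s \<in> {0..1}" for s using lip_path_mspace[OF c(1) that] P by simp
  have A: "A \<in> path_space M p0" using cP[of 0] c by simp
  have "connects M A A \<gamma>" using connects_projected_path[OF M c(1)] c by (simp add: \<gamma>_def)
  then have "lip_homotopic M \<gamma> (\<lambda>_. ?p)" using connects_path_unique[OF A A] connects_const[OF A refl] by blast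
  then obtain L H where H: "slice_homotopy M L \<gamma> (\<lambda>_. ?p) H" by (rule lip_homotopicE)
  have ends: "\<gamma> 0 = ?p" "\<gamma> 1 = ?p" by (simp_all add: \<gamma>_def c)
  have Hb: "H s 0 = \<gamma> s" "H s 1 = ?p" "H 0 s = ?p" "H 1 s = ?p" if "s \<in> {0..1}" for s
    using H that ends by (auto simp: slice_homotopy_def)
  have Hl: "lip_on M L {0..1} (\<lambda>s. H s t)" "lip_on M L {0..1} (H t)" if "t \<in> {0..1}" for t
    using H that by (auto simp: slice_homotopy_def)
  have L0: "0 \<le> L" using Hl(1)[of 0] lip_on_nonneg by fastforce
  define D where "D = {0..1::real} \<times> {0..1::real}"
  define F where "F = (\<lambda>z. H (fst z) (snd z))"
  \<comment> \<open>The distance of the product type is Euclidean; the \<open>L\<^sup>1\<close> distance is at most twice as large.\<close>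
  have F: "lip_on M (L * 2) D F"
  proof (rule lip_onI)
    fix p q assume "p \<in> D" "q \<in> D"
    then have pq: "fst p \<in> {0..1}" "snd p \<in> {0..1}" "fst q \<in> {0..1}" "snd q \<in> {0..1}" by (auto simp: D_def)
    show "F p \<in> mspace M" unfolding F_def using lip_on_mspace[OF Hl(1)] pq by blast
    have "mdist M (F p) (F q) \<le>
        mdist M (F p) (H (fst q) (snd p)) + mdist M (H (fst q) (snd p)) (F q)"
      unfolding F_def using pq by (intro mdist_triangle lip_on_mspace[OF Hl(2)]) auto
    also have "\<dots> \<le> L * dist (fst p) (fst q) + L * dist (snd p) (snd q)"
      unfolding F_def using pq by (intro add_mono lip_onD[OF Hl(1)] lip_onD[OF Hl(2)]) auto
    also have "\<dots> \<le> L * (2 * dist p q)"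
      unfolding distrib_left[symmetric] by (intro mult_left_mono dist_pair_sum_le L0)
    finally show "mdist M (F p) (F q) \<le> L * 2 * dist p q" by simp
  qed (use L0 in simp)
  have D: "convex D" "(0, 0) \<in> D" by (auto simp: D_def intro: convex_Times)
  have F0: "endpoint_proj A = F (0, 0)" using Hb(3)[of 0] by (simp add: F_def)
  obtain G where G: "lip_on ?P (L * 2) D G" "G (0, 0) = A"
    "\<And>x y. x \<in> D \<Longrightarrow> y \<in> D \<Longrightarrow> connects M (G x) (G y) (\<lambda>t. F (segment_path x y t))"
    by (rule convex_domain_lift[OF M F D A F0]) (rule that)
  have GP: "G z \<in> path_space M p0" if "z \<in> D" for z using lip_on_mspace[OF G(1) that] P by simp
  have const: "G x = G y"
    if "x \<in> D" "y \<in> D" and Fp: "\<And>t. t \<in> {0..1} \<Longrightarrow> F (segment_path x y t) = ?p" for x y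
  proof (rule connects_constant_path_eq[OF GP[OF that(1)] GP[OF that(2)] G(3)[OF that(1,2)]])
    show "F (segment_path x y t) = F (segment_path x y 0)" if "t \<in> {0..1}" for t
      using Fp[OF that] Fp[of 0] by simp
  qed
  have coord: "fst (segment_path x y t) = segment_path (fst x) (fst y) t"
    "snd (segment_path x y t) = segment_path (snd x) (snd y) t" for x y :: "real \<times> real" and t
    by (simp_all add: segment_path_def)
  have seg: "segment_path x y t \<in> {0..1}" if "x \<in> {0..1}" "y \<in> {0..1}" "t \<in> {0..1}" for x y t :: real
    using segment_path_in[OF _ that] by auto
  have G1: "lip_on ?P (L * 2) {0..1} (\<lambda>s. G (s, t))" if "t \<in> {0..1}" for t
    using lip_on_compose[OF G(1), of 1 "{0..1}" "\<lambda>s. (s, t)"] that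
    by (auto simp: D_def image_subset_iff lipschitz_on_def dist_Pair_Pair)
  have G2: "lip_on ?P (L * 2) {0..1} (\<lambda>t. G (s, t))" if "s \<in> {0..1}" for s
    using lip_on_compose[OF G(1), of 1 "{0..1}" "\<lambda>t. (s, t)"] that
    by (auto simp: D_def image_subset_iff lipschitz_on_def dist_Pair_Pair)
  have bottom: "G (s, 0) = c s" if s: "s \<in> {0..1}" for s
  proof -
    have sD: "(s, 0) \<in> D" using s by (simp add: D_def)
    obtain K where K: "lip_on ?P K {0..1} c" using c(1) lip_path_iff by blast
    have "lip_path ?P (\<lambda>u. c (segment_path 0 s u))"
      using lip_on_segment_path[OF K, of 0 s] s lip_path_iff by auto
    from connects_projected_path[OF M this]
    have con: "connects M A (c s) (\<lambda>u. \<gamma> (segment_path 0 s u))" by (simp add: c \<gamma>_def)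
    have con': "connects M A (G (s, 0)) (\<lambda>u. F (segment_path (0, 0) (s, 0) u))"
      using G(3)[OF D(2) sD] G(2) by simp
    have "lip_homotopic M (\<lambda>u. \<gamma> (segment_path 0 s u)) (\<lambda>u. F (segment_path (0, 0) (s, 0) u))"
      using connects_lip_path(1)[OF A cP[OF s] con]
      by (rule lip_homotopic_cong) (use s seg Hb in \<open>simp add: F_def coord\<close>)
    then have "connects M A (G (s, 0)) (\<lambda>u. \<gamma> (segment_path 0 s u))" by (rule connects_homotopic[OF con'])
    then show ?thesis using connects_target_unique[OF A GP[OF sD] cP[OF s]] con by blast
  qed
  have left: "G (0, t) = A" if t: "t \<in> {0..1}" for t
    using const[of "(0, 0)" "(0, t)"] t seg Hb G(2) by (simp add: D_def F_def coord)
  have right: "G (1, t) = A" if t: "t \<in> {0..1}" for t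
    using const[of "(1, 0)" "(1, t)"] bottom[of 1] t seg Hb c by (simp add: D_def F_def coord)
  have top: "G (s, 1) = A" if s: "s \<in> {0..1}" for s
    using const[of "(0, 1)" "(s, 1)"] left[of 1] s seg Hb by (simp add: D_def F_def coord)
  have "slice_homotopy ?P (L * 2) c (\<lambda>_. A) (\<lambda>s t. G (s, t))"
    unfolding slice_homotopy_def using G1 G2 bottom left right top c by auto
  then show ?thesis by (rule lip_homotopicI)
qed

theorem lip_simply_connected_path_space:
  assumes M: "tree_like_homotopy_space M"
  shows "lip_simply_connected (path_space_metric M p0)"
  unfolding lip_simply_connected_def path_space_metric_simps[OF M]
proof (intro conjI ballI)
  fix A B assume AB: "A \<in> path_space M p0" "B \<in> path_space M p0"
  obtain \<beta> where "connects M A B \<beta>" using connects_exists[OF AB] .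
  then show "\<exists>G. lip_path (path_space_metric M p0) G \<and> G 0 = A \<and> G 1 = B"
    using connects_imp_path_in_path_space[OF M AB] by blast
next
  fix A assume "A \<in> path_space M p0"
  then show "trivial_group (lip_pi1 (path_space_metric M p0) A)"
    by (intro trivial_lip_pi1I path_space_loop_null_homotopic[OF M])
      (simp_all add: path_space_metric_simps[OF M])
qed

section \<open>Unique lifting\<close>

lemma homotopic_of_null_homotopic_difference:
  assumes a: "lip_path M a" and b: "lip_path M b" and ends: "a 1 = b 1"
    and null: "lip_homotopic M (concat_path a (inverse_path b)) (\<lambda>_. p)"
  shows "lip_homotopic M a b"
proof -
  have p: "p = a 0" "p = b 0" using lip_homotopic_ends[OF null] by simp_all
  note bi = lip_path_inverse_path[OF b]
  have "lip_homotopic M a (concat_path a (\<lambda>_. b 1))"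
    using a ends by (intro lip_homotopic_sym[OF concat_path_const_right]) auto
  also have "lip_homotopic M \<dots> (concat_path a (concat_path (inverse_path b) b))"
    using a b ends by (intro lip_homotopic_concat_path lip_homotopic_refl lip_homotopic_sym[OF concat_path_inverse_left]) auto
  also have "lip_homotopic M \<dots> (concat_path (concat_path a (inverse_path b)) b)"
    using a b bi ends by (intro concat_path_assoc) auto
  also have "lip_homotopic M \<dots> (concat_path (\<lambda>_. p) b)"
    using b by (intro lip_homotopic_concat_path null lip_homotopic_refl) auto
  also have "lip_homotopic M \<dots> b" using b p by (intro concat_path_const_left) auto
  finally show ?thesis .
qed

lemma compose_concat_path: "f \<circ> concat_path a b = concat_path (f \<circ> a) (f \<circ> b)"
  by (auto simp: concat_path_def)

lemma compose_inverse_path: "f \<circ> inverse_path a = inverse_path (f \<circ> a)"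
  by (auto simp: inverse_path_def)

lemma lip_path_image: "lip_path X a \<Longrightarrow> Lipschitz_continuous_map X M f \<Longrightarrow> lip_path M (f \<circ> a)"
  unfolding lip_path_def by (rule Lipschitz_continuous_map_compose)

lemma length_of_image_le:
  assumes a: "lip_path X a" and B: "0 \<le> B"
    and f: "\<And>x y. x \<in> mspace X \<Longrightarrow> y \<in> mspace X \<Longrightarrow> mdist M (f x) (f y) \<le> B * mdist X x y"
  shows "length_of M (f \<circ> a) \<le> B * length_of X a"
proof (rule length_on_le)
  obtain L where L: "lip_on X L {0..1} a" using a lip_path_iff by blast
  fix n t assume t: "is_partition 0 1 n t"
  have "partition_sum M (f \<circ> a) n t \<le> (\<Sum>i<n. B * mdist X (a (t i)) (a (t (Suc i))))"
    unfolding partition_sum_def o_def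
    by (rule sum_mono, rule f) (auto intro!: lip_on_mspace[OF L] simp: is_partition_range[OF t, simplified])
  also have "\<dots> = B * partition_sum X a n t" by (simp add: partition_sum_def sum_distrib_left)
  also have "\<dots> \<le> B * length_of X a"
    using partition_sum_le_length_on[OF L t] B by (rule mult_left_mono)
  finally show "partition_sum M (f \<circ> a) n t \<le> B * length_of X a" .
qed simp

lemma trivial_induced_map_null_homotopic:
  assumes triv: "trivial_homomorphism (lip_pi1 X x0) (lip_pi1 M p0) (induced_map M f)"
    and f: "Lipschitz_continuous_map X M f"
    and a: "lip_path X a" "a 0 = x0" "a 1 = x0"
  shows "lip_homotopic M (f \<circ> a) (\<lambda>_. p0)"
proof -
  have "path_class X a \<in> carrier (lip_pi1 X x0)" using a by (auto simp: lip_pi1_def)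
  then have "induced_map M f (path_class X a) = path_class M (\<lambda>_. p0)"
    using triv by (simp add: trivial_homomorphism_def lip_pi1_def)
  moreover have "f \<circ> a \<in> induced_map M f (path_class X a)"
    unfolding induced_map_def using path_class_self[OF a(1)] path_class_self[OF lip_path_image[OF a(1) f]] by blast
  ultimately have "f \<circ> a \<in> path_class M (\<lambda>_. p0)" by metis
  then show ?thesis unfolding path_class_def by (blast intro: lip_homotopic_sym)
qed

text \<open>The lift of \<open>f\<close> sends \<open>x\<close> to the class of \<open>f \<circ> \<sigma>\<close>, where \<open>\<sigma>\<close> is any path from \<open>x0\<close> to \<open>x\<close>.\<close>

lemma lift_exists:
  assumes M: "tree_like_homotopy_space M" and X: "quasi_convex X" and f: "based_lip_map X x0 M p0 f"
    and triv: "trivial_homomorphism (lip_pi1 X x0) (lip_pi1 M p0) (induced_map M f)"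
  obtains g where "based_lip_map X x0 (path_space_metric M p0) (path_class M (\<lambda>_. p0)) g"
    "\<And>x. x \<in> mspace X \<Longrightarrow> endpoint_proj (g x) = f x"
proof -
  note P = path_space_metric_simps[OF M, of p0]
  have x0: "x0 \<in> mspace X" and p0: "p0 \<in> mspace M" and fL: "Lipschitz_continuous_map X M f" and fx0: "f x0 = p0"
    using f by (auto simp: based_lip_map_def)
  obtain B where B: "B > 0"
    "\<And>x y. x \<in> mspace X \<Longrightarrow> y \<in> mspace X \<Longrightarrow> mdist M (f x) (f y) \<le> B * mdist X x y"
    using fL by (auto simp: Lipschitz_continuous_map_pos)
  obtain C where C: "C \<ge> 1" "quasi_convex_with C X" using X by (auto simp: quasi_convex_def)
  have "\<exists>\<sigma>. lip_path X \<sigma> \<and> \<sigma> 0 = x0 \<and> \<sigma> 1 = x" if "x \<in> mspace X" for x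
    using C(2) x0 that unfolding quasi_convex_with_def by blast
  then obtain \<sigma> where \<sigma>: "\<And>x. x \<in> mspace X \<Longrightarrow> lip_path X (\<sigma> x)" "\<And>x. x \<in> mspace X \<Longrightarrow> \<sigma> x 0 = x0"
    "\<And>x. x \<in> mspace X \<Longrightarrow> \<sigma> x 1 = x" by metis
  define g where "g = (\<lambda>x. path_class M (f \<circ> \<sigma> x))"
  have f\<sigma>: "lip_path M (f \<circ> \<sigma> x)" "(f \<circ> \<sigma> x) 0 = p0" "(f \<circ> \<sigma> x) 1 = f x" if "x \<in> mspace X" for x
    using \<sigma>[OF that] lip_path_image[OF _ fL] fx0 by auto
  have gP: "g x \<in> path_space M p0" if "x \<in> mspace X" for x
    unfolding g_def using f\<sigma>[OF that] by (intro path_class_in_path_space)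
  have gend: "endpoint_proj (g x) = f x" if "x \<in> mspace X" for x
    unfolding g_def using f\<sigma>[OF that] by (simp add: endpoint_proj_path_class)
  have con: "connects M (g x) (g y) (f \<circ> \<zeta>)"
    if xy: "x \<in> mspace X" "y \<in> mspace X" and \<zeta>: "lip_path X \<zeta>" "\<zeta> 0 = x" "\<zeta> 1 = y" for x y \<zeta>
  proof -
    \<comment> \<open>Triviality of \<open>f\<^sub>#\<close> is applied to the loop from \<open>x0\<close> to \<open>x\<close>, along \<open>\<zeta>\<close> to \<open>y\<close>, and back.\<close>
    let ?a = "concat_path (\<sigma> x) \<zeta>"
    have a: "lip_path X ?a" using \<sigma> xy \<zeta> by (simp add: lip_path_concat_path)
    have "lip_path X (concat_path ?a (inverse_path (\<sigma> y)))"
      using a \<sigma> xy \<zeta> by (simp add: lip_path_concat_path lip_path_inverse_path)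
    then have "lip_homotopic M (f \<circ> concat_path ?a (inverse_path (\<sigma> y))) (\<lambda>_. p0)"
      using \<sigma> xy by (intro trivial_induced_map_null_homotopic[OF triv fL]) auto
    then have "lip_homotopic M (concat_path (f \<circ> ?a) (inverse_path (f \<circ> \<sigma> y))) (\<lambda>_. p0)"
      by (simp add: compose_concat_path compose_inverse_path)
    then have "lip_homotopic M (f \<circ> ?a) (f \<circ> \<sigma> y)"
      by (rule homotopic_of_null_homotopic_difference[OF lip_path_image[OF a fL] f\<sigma>(1)[OF xy(2)], rotated])
        (use \<sigma>[OF xy(2)] \<zeta> in simp)
    then show ?thesis
      unfolding g_def using f\<sigma>[OF xy(1)] f\<sigma>[OF xy(2)] lip_path_image[OF \<zeta>(1) fL] \<zeta>
      by (subst connects_iff) (auto simp: compose_concat_path)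
  qed
  have g: "Lipschitz_continuous_map X (path_space_metric M p0) g"
    unfolding Lipschitz_continuous_map_def P
  proof (intro conjI exI ballI)
    show "g \<in> mspace X \<rightarrow> path_space M p0" using gP by auto
    fix x y assume xy: "x \<in> mspace X" "y \<in> mspace X"
    then obtain \<zeta> where \<zeta>: "lip_path X \<zeta>" "\<zeta> 0 = x" "\<zeta> 1 = y" "length_of X \<zeta> \<le> C * mdist X x y"
      using C(2) unfolding quasi_convex_with_def by blast
    have "path_space_dist M p0 (g x) (g y) \<le> length_of M (f \<circ> \<zeta>)"
      using gP xy con[OF xy \<zeta>(1-3)] by (intro path_space_dist_le)
    also have "\<dots> \<le> B * length_of X \<zeta>"
      using \<zeta>(1) B by (intro length_of_image_le) auto
    also have "\<dots> \<le> B * (C * mdist X x y)" using \<zeta>(4) B by (intro mult_left_mono) auto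
    finally show "path_space_dist M p0 (g x) (g y) \<le> B * C * mdist X x y" by (simp add: mult.assoc)
  qed
  have "lip_homotopic M (f \<circ> \<sigma> x0) (\<lambda>_. p0)"
    using \<sigma>[OF x0] by (intro trivial_induced_map_null_homotopic[OF triv fL])
  then have g0: "g x0 = path_class M (\<lambda>_. p0)"
    unfolding g_def using f\<sigma>(1)[OF x0] by (simp add: path_class_eq_iff)
  show thesis
  proof
    show "based_lip_map X x0 (path_space_metric M p0) (path_class M (\<lambda>_. p0)) g"
      using x0 g g0 gP[OF x0] by (simp add: based_lip_map_def P)
  qed (rule gend)
qed

text \<open>
  Along a path \<open>\<sigma>\<close> from \<open>x0\<close> to \<open>x\<close>, every lift of \<open>f\<close> is a path in the path space over \<open>f \<circ> \<sigma>\<close>, and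
  by unique path lifting its end point is \<open>A\<close> continued along \<open>f \<circ> \<sigma>\<close>.
\<close>

lemma lift_unique:
  assumes M: "tree_like_homotopy_space M" and X: "quasi_convex X"
    and g: "based_lip_map X x0 (path_space_metric M p0) A g" "\<And>x. x \<in> mspace X \<Longrightarrow> endpoint_proj (g x) = f x"
    and h: "based_lip_map X x0 (path_space_metric M p0) A h" "\<And>x. x \<in> mspace X \<Longrightarrow> endpoint_proj (h x) = f x"
    and x: "x \<in> mspace X"
  shows "g x = h x"
proof -
  note P = path_space_metric_simps[OF M, of p0]
  have x0: "x0 \<in> mspace X" using g by (simp add: based_lip_map_def)
  obtain \<sigma> where \<sigma>: "lip_path X \<sigma>" "\<sigma> 0 = x0" "\<sigma> 1 = x"
    using X x x0 unfolding quasi_convex_def quasi_convex_with_def by blast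
  have con: "k x \<in> path_space M p0 \<and> A \<in> path_space M p0 \<and> connects M A (k x) (f \<circ> \<sigma>)"
    if k: "based_lip_map X x0 (path_space_metric M p0) A k" "\<And>x. x \<in> mspace X \<Longrightarrow> endpoint_proj (k x) = f x" for k
  proof -
    have kL: "Lipschitz_continuous_map X (path_space_metric M p0) k" and k0: "k x0 = A"
      using k by (auto simp: based_lip_map_def)
    have S: "A \<in> path_space M p0" "k x \<in> path_space M p0"
      using Lipschitz_continuous_map_image[OF kL] x x0 k0 by (auto simp: P)
    have c: "connects M A (k x) (\<lambda>s. endpoint_proj (k (\<sigma> s)))"
      using connects_projected_path[OF M lip_path_image[OF \<sigma>(1) kL]] \<sigma> k0 by simp
    have "lip_homotopic M (\<lambda>s. endpoint_proj (k (\<sigma> s))) (f \<circ> \<sigma>)"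
      using lip_path_mspace[OF \<sigma>(1)] k(2) by (intro lip_homotopic_cong connects_lip_path(1)[OF S c]) simp
    with S show ?thesis using connects_homotopic[OF c lip_homotopic_sym] by simp
  qed
  show ?thesis
    using con[OF g] con[OF h] connects_target_unique[of A M p0 "g x" "h x" "f \<circ> \<sigma>"] by simp
qed

theorem unique_lifting_path_space:
  assumes M: "tree_like_homotopy_space M" and p0: "p0 \<in> mspace M"
  shows "unique_lifting_property TYPE('x) (path_space_metric M p0) (path_class M (\<lambda>_. p0)) M p0 endpoint_proj"
  unfolding unique_lifting_property_def
proof (intro conjI allI impI)
  note P = path_space_metric_simps[OF M, of p0]
  have base: "path_class M (\<lambda>_. p0) \<in> path_space M p0"
    using lip_path_const[OF p0] by (rule path_class_in_path_space) simp
  have "Lipschitz_continuous_map (path_space_metric M p0) M endpoint_proj"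
    unfolding Lipschitz_continuous_map_def P
    using endpoint_proj_mspace mdist_endpoint_proj_le by (intro conjI exI[of _ 1] ballI) auto
  then show "based_lip_map (path_space_metric M p0) (path_class M (\<lambda>_. p0)) M p0 endpoint_proj"
    using base p0 endpoint_proj_path_class[OF lip_path_const[OF p0]] by (simp add: based_lip_map_def P)
  fix X :: "'x metric" and x0 f
  let ?e = "path_class M (\<lambda>_. p0)" and ?E = "path_space_metric M p0"
  assume "quasi_convex X \<and> based_lip_map X x0 M p0 f \<and>
    trivial_homomorphism (lip_pi1 X x0) (lip_pi1 M p0) (induced_map M f)"
  then have X: "quasi_convex X" and f: "based_lip_map X x0 M p0 f"
    and triv: "trivial_homomorphism (lip_pi1 X x0) (lip_pi1 M p0) (induced_map M f)" by auto
  obtain g where g: "based_lip_map X x0 ?E ?e g" "\<And>x. x \<in> mspace X \<Longrightarrow> endpoint_proj (g x) = f x"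
    using lift_exists[OF M X f triv] by blast
  let ?g = "restrict g (mspace X)"
  show "\<exists>!g. g \<in> extensional (mspace X) \<and> based_lip_map X x0 ?E ?e g \<and>
      (\<forall>x\<in>mspace X. endpoint_proj (g x) = f x)"
  proof (rule ex1I[of _ ?g])
    have "Lipschitz_continuous_map X ?E ?g"
      using g(1) by (auto simp: based_lip_map_def intro: Lipschitz_continuous_map_eq[of X ?E g])
    then have "based_lip_map X x0 ?E ?e ?g" using g(1) by (simp add: based_lip_map_def)
    then show "?g \<in> extensional (mspace X) \<and> based_lip_map X x0 ?E ?e ?g \<and>
        (\<forall>x\<in>mspace X. endpoint_proj (?g x) = f x)"
      using g(2) by simp
    fix h assume h: "h \<in> extensional (mspace X) \<and> based_lip_map X x0 ?E ?e h \<and>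
        (\<forall>x\<in>mspace X. endpoint_proj (h x) = f x)"
    show "h = ?g"
    proof (rule extensionalityI[of _ "mspace X"])
      fix x assume "x \<in> mspace X"
      then show "h x = ?g x" using lift_unique[OF M X _ _ g, of h] h by simp
    qed (use h in auto)
  qed
qed

theorem corollary4p8:
  fixes M :: "'a metric" and p0 :: 'a
  assumes "tree_like_homotopy_space M" and "p0 \<in> mspace M"
  shows "Metric_space (path_space M p0) (path_space_dist M p0) \<and>
    unique_lifting_property TYPE('x)
      (path_space_metric M p0) (path_class M (\<lambda>_. p0)) M p0 endpoint_proj \<and>
    lip_simply_connected (path_space_metric M p0) \<and>
    length_space (path_space_metric M p0)"
  using Metric_space_path_space[OF assms(1)] unique_lifting_path_space[OF assms]
    lip_simply_connected_path_space[OF assms(1)] length_space_path_space[OF assms(1)]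
  by blast

end
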